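(* Let $F(a,b)$ be the free group of rank two on $\{a,b\}$. The following problem is algorithmically decidable: given a finitely generated subgroup $H$ of $F(a,b)$ (by a finite list of generating words), does there exist $\phi\in\operatorname{Aut} F(a,b)$ such that $\phi(H)\le\langle a, a^b\rangle$?
   Context: Here $a^b=b^{-1}ab$, and $\langle a,a^b\rangle$ is the subgroup generated by $a$ and $a^b$. *)

theory Defs
  imports "HOL-Algebra.Bij" "HOL-Algebra.Generated_Groups" "HOL-Library.Nat_Bijection"
begin

section \<open>Free groups\<close>

text \<open>A letter \<open>(x, True)\<close> stands for the generator \<open>x\<close> and \<open>(x, False)\<close> for its inverse.\<close>

type_synonym 'a letter = "'a \<times> bool"
type_synonym 'a word = "'a letter list"

definition inv_letter :: "'a letter \<Rightarrow> 'a letter" where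
  "inv_letter x = (fst x, \<not> snd x)"

definition reduced :: "'a word \<Rightarrow> bool" where
  "reduced w \<longleftrightarrow> successively (\<lambda>x y. y \<noteq> inv_letter x) w"

fun cancel_cons :: "'a letter \<Rightarrow> 'a word \<Rightarrow> 'a word" where
  "cancel_cons x [] = [x]"
| "cancel_cons x (y # w) = (if y = inv_letter x then w else x # y # w)"

definition reduce :: "'a word \<Rightarrow> 'a word" where
  "reduce w = foldr cancel_cons w []"

text \<open>The free group whose basis is the set of all elements of the type \<open>'a\<close>.\<close>

definition free_group :: "'a word monoid" where
  "free_group = \<lparr>carrier = {w. reduced w}, monoid.mult = (\<lambda>u v. reduce (u @ v)), one = []\<rparr>"

definition gen :: "'a \<Rightarrow> 'a word" where
  "gen x = [(x, True)]"

lemma inv_letter_inv_letter [simp]: "inv_letter (inv_letter x) = x"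
  by (simp add: inv_letter_def)

lemma reduced_Nil [simp]: "reduced []"
  by (simp add: reduced_def)

lemma reduced_Cons:
  "reduced (x # w) \<longleftrightarrow> reduced w \<and> (w = [] \<or> hd w \<noteq> inv_letter x)"
  by (cases w) (auto simp: reduced_def)

lemma reduced_cancel_cons: "reduced w \<Longrightarrow> reduced (cancel_cons x w)"
  by (cases w) (auto simp: reduced_Cons)

lemma reduced_foldr: "reduced w \<Longrightarrow> reduced (foldr cancel_cons u w)"
  by (induction u) (auto simp: reduced_cancel_cons)

lemma reduced_reduce: "reduced (reduce w)"
  by (simp add: reduce_def reduced_foldr)

lemma reduce_reduced: "reduced w \<Longrightarrow> reduce w = w"
proof (induction w)
  case (Cons x w)
  then show ?case by (cases w) (auto simp: reduce_def reduced_Cons)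
qed (simp add: reduce_def)

lemma cancel_cons_inverse:
  assumes "reduced w"
  shows "cancel_cons (inv_letter x) (cancel_cons x w) = w"
    and "cancel_cons x (cancel_cons (inv_letter x) w) = w"
proof -
  have *: "cancel_cons (inv_letter z) (cancel_cons z w) = w" for z
  proof (cases w)
    case (Cons y v)
    then show ?thesis using assms by (cases v) (auto simp: reduced_Cons)
  qed auto
  show "cancel_cons (inv_letter x) (cancel_cons x w) = w" by (rule *)
  show "cancel_cons x (cancel_cons (inv_letter x) w) = w" using *[of "inv_letter x"] by simp
qed

lemma foldr_cancel_cons:
  "reduced w \<Longrightarrow> foldr cancel_cons (cancel_cons x u) w = cancel_cons x (foldr cancel_cons u w)"
  by (cases u) (auto simp: cancel_cons_inverse reduced_foldr)

lemma foldr_reduce: "reduced w \<Longrightarrow> foldr cancel_cons (reduce u) w = foldr cancel_cons u w"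
  by (induction u) (auto simp: reduce_def foldr_cancel_cons)

lemma reduce_append: "reduce (u @ v) = foldr cancel_cons u (reduce v)"
  by (simp add: reduce_def)

lemma reduce_append_left: "reduce (reduce u @ v) = reduce (u @ v)"
  by (simp add: reduce_append foldr_reduce reduced_reduce)

lemma reduce_append_right: "reduce (u @ reduce v) = reduce (u @ v)"
  by (simp add: reduce_append reduce_reduced reduced_reduce)

lemma reduce_inverse: "reduce (rev (map inv_letter w) @ w) = []"
proof (induction w)
  case (Cons x w)
  have "reduce (rev (map inv_letter (x # w)) @ x # w)
      = foldr cancel_cons (rev (map inv_letter w)) (cancel_cons (inv_letter x) (cancel_cons x (reduce w)))"
    by (simp add: reduce_def)
  also have "\<dots> = []"
    using Cons by (simp add: cancel_cons_inverse reduced_reduce flip: reduce_append)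
  finally show ?case .
qed (simp add: reduce_def)

lemma group_free_group: "group (free_group :: 'a word monoid)"
proof (rule groupI)
  fix x :: "'a word" assume "x \<in> carrier free_group"
  then show "\<exists>y\<in>carrier free_group. y \<otimes>\<^bsub>free_group\<^esub> x = \<one>\<^bsub>free_group\<^esub>"
    by (intro bexI[of _ "reduce (rev (map inv_letter x))"])
      (simp_all add: free_group_def reduce_append_left reduce_inverse reduced_reduce)
qed (simp_all add: free_group_def reduced_reduce reduce_append_left reduce_append_right reduce_reduced)

definition eval_word :: "('b, 'c) monoid_scheme \<Rightarrow> ('a \<Rightarrow> 'b) \<Rightarrow> 'a word \<Rightarrow> 'b" where
  "eval_word G f w =
     foldr (\<lambda>x g. (if snd x then f (fst x) else inv\<^bsub>G\<^esub> f (fst x)) \<otimes>\<^bsub>G\<^esub> g) w \<one>\<^bsub>G\<^esub>"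

text \<open>The universal property of \<^const>\<open>free_group\<close>.\<close>

lemma free_group_hom:
  assumes "group G" and f: "\<And>x. f x \<in> carrier G"
  shows "eval_word G f \<in> hom free_group G" and "eval_word G f (gen x) = f x"
proof -
  interpret group G by fact
  have closed [simp]: "eval_word G f w \<in> carrier G" for w
    by (induction w) (auto simp: eval_word_def f)
  have cons: "eval_word G f (cancel_cons x w) = eval_word G f (x # w)" for x w
  proof (cases w)
    case (Cons y v)
    have "eval_word G f v \<in> carrier G" by simp
    then show ?thesis
      unfolding Cons by (auto simp: eval_word_def inv_letter_def f m_assoc[symmetric])
  qed auto
  have red: "eval_word G f (reduce w) = eval_word G f w" for w
    by (induction w) (auto simp: reduce_def cons, auto simp: eval_word_def)
  have app: "eval_word G f (u @ v) = eval_word G f u \<otimes>\<^bsub>G\<^esub> eval_word G f v" for u v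
  proof (induction u)
    case Nil
    have "eval_word G f v \<in> carrier G" by simp
    then show ?case by (simp add: eval_word_def)
  next
    case (Cons x u)
    have "eval_word G f u \<in> carrier G" "eval_word G f v \<in> carrier G" by simp_all
    with Cons show ?case by (simp add: eval_word_def f m_assoc)
  qed
  show "eval_word G f \<in> hom free_group G"
    by (auto simp: hom_def free_group_def red app)
  show "eval_word G f (gen x) = f x"
    by (simp add: eval_word_def gen_def f)
qed

lemma free_group_generated:
  "generate free_group (range gen) = carrier (free_group :: 'a word monoid)"
proof
  let ?F = "free_group :: 'a word monoid"
  interpret F: group ?F by (rule group_free_group)
  have "range gen \<subseteq> carrier ?F"
    by (auto simp: gen_def free_group_def reduced_def)
  then show "generate ?F (range gen) \<subseteq> carrier ?F"
    by (rule F.generate_incl)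
  have letter: "[x] \<in> generate ?F (range gen)" for x :: "'a letter"
  proof (cases x)
    case (Pair a b)
    have g: "gen a \<in> generate ?F (range gen)" by (simp add: generate.incl)
    have i: "inv\<^bsub>?F\<^esub> gen a \<in> generate ?F (range gen)" by (simp add: generate.inv)
    have "inv\<^bsub>?F\<^esub> gen a = [(a, False)]"
      by (rule F.inv_equality)
        (auto simp: gen_def free_group_def reduced_def reduce_def inv_letter_def)
    with g i Pair show ?thesis by (cases b) (simp_all add: gen_def)
  qed
  show "carrier ?F \<subseteq> generate ?F (range gen)"
  proof
    fix w :: "'a word" assume "w \<in> carrier ?F"
    then have "reduced w" by (simp add: free_group_def)
    then show "w \<in> generate ?F (range gen)"
    proof (induction w)
      case Nil
      then show ?case using generate.one[of ?F "range gen"] by (simp add: free_group_def)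
    next
      case (Cons x w)
      then have "[x] \<otimes>\<^bsub>?F\<^esub> w = x # w"
        using reduce_reduced[of "x # w"] by (simp add: free_group_def)
      moreover have "w \<in> generate ?F (range gen)" using Cons by (simp add: reduced_Cons)
      ultimately show ?case using generate.eng[OF letter] by metis
    qed
  qed
qed

definition conjugate :: "('a, 'b) monoid_scheme \<Rightarrow> 'a \<Rightarrow> 'a \<Rightarrow> 'a" where
  "conjugate G x y = inv\<^bsub>G\<^esub> y \<otimes>\<^bsub>G\<^esub> x \<otimes>\<^bsub>G\<^esub> y"


section \<open>The free group of rank two\<close>

datatype basis = A | B

abbreviation F2 :: "basis word monoid" where "F2 \<equiv> free_group"

text \<open>A list of words, which need not be reduced, describes the subgroup generated by
  the elements that the words represent.\<close>

definition subgroup_of_words :: "basis word list \<Rightarrow> basis word set" where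
  "subgroup_of_words ws = generate F2 (reduce ` set ws)"


section \<open>Computability\<close>

text \<open>The general recursive functions: \<open>recursive n f\<close> states that \<open>f\<close>, restricted to lists of
  length \<open>n\<close>, is a total recursive function of \<open>n\<close> arguments. Minimisation is only applied to
  functions that have a zero for all values of the parameters, so that all functions are total;
  by Kleene's normal form theorem every total computable function is obtained.\<close>

inductive recursive :: "nat \<Rightarrow> (nat list \<Rightarrow> nat) \<Rightarrow> bool" where
  zero: "recursive n (\<lambda>xs. 0)"
| succ: "recursive 1 (\<lambda>xs. Suc (hd xs))"
| proj: "i < n \<Longrightarrow> recursive n (\<lambda>xs. xs ! i)"
| comp: "recursive (length fs) g \<Longrightarrow> (\<And>f. f \<in> set fs \<Longrightarrow> recursive n f) \<Longrightarrow>
    recursive n (\<lambda>xs. g (map (\<lambda>f. f xs) fs))"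
| prim_rec: "recursive n f \<Longrightarrow> recursive (Suc (Suc n)) g \<Longrightarrow>
    recursive (Suc n) (\<lambda>xs. rec_nat (f (tl xs)) (\<lambda>k r. g (k # r # tl xs)) (hd xs))"
| minim: "recursive (Suc n) f \<Longrightarrow> (\<And>xs. length xs = n \<Longrightarrow> \<exists>k. f (k # xs) = 0) \<Longrightarrow>
    recursive n (\<lambda>xs. LEAST k. f (k # xs) = 0)"

fun letter_code :: "basis letter \<Rightarrow> nat" where
  "letter_code (A, True) = 0"
| "letter_code (A, False) = 1"
| "letter_code (B, True) = 2"
| "letter_code (B, False) = 3"

definition word_code :: "basis word \<Rightarrow> nat" where
  "word_code w = list_encode (map letter_code w)"

definition words_code :: "basis word list \<Rightarrow> nat" where
  "words_code ws = list_encode (map word_code ws)"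

lemma inj_words_code: "inj words_code"
proof -
  have "inj letter_code"
  proof (rule injI)
    fix x y show "letter_code x = letter_code y \<Longrightarrow> x = y"
      by (cases x rule: letter_code.cases; cases y rule: letter_code.cases) auto
  qed
  then have "inj word_code"
    unfolding word_code_def by (intro injI) (simp add: list_encode_eq inj_map_eq_map)
  then show ?thesis
    unfolding words_code_def by (intro injI) (simp add: list_encode_eq inj_map_eq_map)
qed

definition decidable :: "basis word list set \<Rightarrow> bool" where
  "decidable P \<longleftrightarrow> (\<exists>f. recursive 1 f \<and> (\<forall>ws. f [words_code ws] = (if ws \<in> P then 1 else 0)))"

end

theory Submission
  imports Defs
begin

text \<open>
  Write \<open>K = \<langle>a, a\<^sup>b\<rangle>\<close>. An automorphism carries \<open>H\<close> into \<open>K\<close> iff \<open>H\<close> lies in \<open>\<langle>x, x\<^sup>y\<rangle>\<close> for some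
  basis \<open>(x, y)\<close>. Replacing \<open>y\<close> by another partner of \<open>x\<close> only conjugates this subgroup, so up to
  conjugacy there is one such subgroup for every isotopy class of essential simple closed curves \<open>x\<close> on the
  punctured torus. These are infinitely many; decidability follows once the length of \<open>x\<close> is bounded by the
  lengths of the generators of \<open>H\<close>.

  By Nielsen's theorem (\<open>nielsen_induct\<close>) every automorphism is a product of permutations of the
  letters, transvections and inner automorphisms. From this one gets the shape of the
  subgroups (\<open>normal_if_embeds\<close>): up to conjugation and a signed permutation of the letters, each is
  \<open>K\<close>, or \<open>\<langle>b, b\<^sup>a\<rangle>\<close>, or \<open>\<langle>p a b, p b a\<rangle>\<close>, where the positive word \<open>p\<close> is built by iterating the
  substitutions \<open>a \<mapsto> b a\<close> and \<open>b \<mapsto> a b\<close>; then \<open>p a b\<close> is a conjugate of a Christoffel word.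

  The folded graph of \<open>\<langle>p a b, p b a\<rangle>\<close> is a theta graph with one long arc, labelled \<open>p\<close>, and two arcs of
  length two, labelled \<open>a b\<close> and \<open>b a\<close>. Let the generators of \<open>H\<close> have length at most \<open>L\<close>. After
  conjugation by an element of length at most \<open>L / 2\<close> they are loops of length at most \<open>L\<close> at one
  vertex of the graph (\<open>short_conjugator\<close>). If the long arc has at least \<open>4 L + 4\<close> edges, then one of
  its edges is used by none of these loops (\<open>cut_label_loops\<close>). Without that edge the only
  cycle left is the short one, so \<open>H\<close> lies in a conjugate of \<open>\<langle>a b, b a\<rangle>\<close>, the case where \<open>p\<close> is empty.
  In every case \<open>p\<close> can be chosen of length at most \<open>4 L + 4\<close>, and the conjugator is bounded too
  (\<open>bounded_normal_form\<close>).

  Since \<open>a \<mapsto> b a\<close> maps \<open>K\<close> onto \<open>\<langle>a b, b a\<rangle>\<close>, it follows that \<open>H\<close> can be carried into \<open>K\<close> iff some product of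
  exactly \<open>150 L + 82\<close> automorphisms from a fixed finite set carries it into \<open>\<langle>a b, b a\<rangle>\<close>
  (\<open>moves_if_embeddable\<close>, \<open>embeddable_if_moves\<close>). The algorithm tries all these products. To
  recognise success it reduces the images of the given words and reads them in the theta
  graph with empty long arc. That this search is recursive is shown with a calculus of
  computable functions between encoded types (\<open>computable_foldl\<close>, \<open>computable_bounded_ex\<close>).
\<close>

section \<open>The free group in additive notation\<close>

definition inv_word :: "'a word \<Rightarrow> 'a word" where
  "inv_word w = rev (map inv_letter w)"

lemma inv_word_simps [simp]:
  "inv_word [] = []" "inv_word (x # w) = inv_word w @ [inv_letter x]"
  "inv_word (u @ v) = inv_word v @ inv_word u" "inv_word (inv_word w) = w"
  "length (inv_word w) = length w" "inv_word w = [] \<longleftrightarrow> w = []"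
  by (auto simp: inv_word_def rev_map comp_def)

lemma inv_letter_neq [simp]: "inv_letter x \<noteq> x" "x \<noteq> inv_letter x"
  by (auto simp: inv_letter_def prod_eq_iff)

lemma inv_letter_eq_iff [simp]: "inv_letter x = inv_letter y \<longleftrightarrow> x = y"
  by (auto simp: inv_letter_def prod_eq_iff)

lemma fst_inv_letter [simp]: "fst (inv_letter x) = fst x"
  by (simp add: inv_letter_def)

lemma same_generator_iff: "fst x = fst y \<longleftrightarrow> x = y \<or> x = inv_letter y"
  by (auto simp: inv_letter_def prod_eq_iff)

lemma reduced_append:
  "reduced (u @ v) \<longleftrightarrow> reduced u \<and> reduced v \<and> (u = [] \<or> v = [] \<or> hd v \<noteq> inv_letter (last u))"
  by (auto simp: reduced_def successively_append_iff)

lemma reduced_inv_word [simp]: "reduced (inv_word w) \<longleftrightarrow> reduced w"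
proof -
  have "reduced (inv_word w)" if "reduced w" for w :: "'a word"
    using that
  proof (induction w)
    case (Cons x w)
    then show ?case
      by (cases w) (auto simp: reduced_append reduced_Cons)
  qed simp
  from this[of w] this[of "inv_word w"] show ?thesis by auto
qed

lemma reduce_inv_word [simp]: "reduce (inv_word w @ w) = []" "reduce (w @ inv_word w) = []"
  using reduce_inverse[of w] reduce_inverse[of "inv_word w"]
  by (auto simp: inv_word_def rev_map comp_def)

lemma length_reduce: "length (reduce w) \<le> length w"
proof -
  have "length (cancel_cons x v) \<le> Suc (length v)" for x and v :: "'a word" by (cases v) auto
  then show ?thesis
    by (induction w) (auto simp: reduce_def intro: order_trans)
qed

text \<open>The free group becomes a type of class \<^class>\<open>group_add\<close>, a class that does not assume
  commutativity. Equations between group elements can then be proved by the simplifier.\<close>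

typedef 'a fg = "{w :: 'a word. reduced w}" morphisms word_of Abs_fg
  by (rule exI[of _ "[]"]) simp

lemma reduced_word_of [simp]: "reduced (word_of x)"
  using word_of[of x] by simp

definition of_word :: "'a word \<Rightarrow> 'a fg" where
  "of_word w = Abs_fg (reduce w)"

lemma word_of_of_word: "word_of (of_word w) = reduce w"
  by (simp add: of_word_def Abs_fg_inverse reduced_reduce)

lemma of_word_word_of [simp]: "of_word (word_of x) = x"
  by (simp add: of_word_def reduce_reduced word_of_inverse)

lemma of_word_eq_iff: "of_word u = of_word v \<longleftrightarrow> reduce u = reduce v"
  using word_of_inject[of "of_word u" "of_word v"] by (simp add: word_of_of_word)

instantiation fg :: (type) group_add
begin

definition "0 = of_word ([] :: 'a word)"
definition "x + y = of_word (word_of x @ word_of y)" for x y :: "'a fg"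
definition "- x = of_word (inv_word (word_of x))" for x :: "'a fg"
definition "x - y = x + - y" for x y :: "'a fg"

instance
proof
  fix x y z :: "'a fg"
  show "x + y + z = x + (y + z)"
    unfolding plus_fg_def of_word_eq_iff word_of_of_word reduce_append_left reduce_append_right by simp
  show "0 + x = x" "x + 0 = x"
    unfolding plus_fg_def zero_fg_def word_of_of_word by (simp_all add: reduce_reduced)
  show "- x + x = 0"
    unfolding plus_fg_def zero_fg_def uminus_fg_def word_of_of_word of_word_eq_iff reduce_append_left
    by (simp add: reduce_reduced)
  show "x + - y = x - y" by (simp add: minus_fg_def)
qed

end

lemma of_word_Nil [simp]: "of_word [] = 0"
  by (simp add: zero_fg_def)

lemma of_word_append: "of_word (u @ v) = of_word u + of_word v"
  unfolding plus_fg_def of_word_eq_iff word_of_of_word reduce_append_left reduce_append_right ..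

lemma of_word_inv_word: "of_word (inv_word w) = - of_word w"
proof -
  have "of_word (inv_word w @ w) = of_word []"
    unfolding of_word_eq_iff by (simp add: reduce_reduced)
  then have "of_word (inv_word w) + of_word w = 0"
    unfolding of_word_append by simp
  then show ?thesis by (simp add: eq_neg_iff_add_eq_0)
qed

lemma word_of_zero [simp]: "word_of 0 = []"
  unfolding zero_fg_def word_of_of_word by (simp add: reduce_reduced)

lemma word_of_eq_Nil_iff [simp]: "word_of x = [] \<longleftrightarrow> x = 0"
  using word_of_inject[of x 0] by simp

lemma word_of_uminus: "word_of (- x) = inv_word (word_of x)"
  by (simp add: uminus_fg_def word_of_of_word reduce_reduced)

lemma word_of_eqI: "reduced w \<Longrightarrow> x = of_word w \<Longrightarrow> word_of x = w"
  by (simp add: word_of_of_word reduce_reduced)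

definition len :: "'a fg \<Rightarrow> nat" where
  "len x = length (word_of x)"

lemma len_of_word: "len (of_word w) \<le> length w"
  by (simp add: len_def word_of_of_word length_reduce)

lemma len_zero [simp]: "len 0 = 0"
  by (simp add: len_def)

lemma len_eq_0_iff [simp]: "len x = 0 \<longleftrightarrow> x = 0"
  by (simp add: len_def)

lemma len_uminus [simp]: "len (- x) = len x"
  by (simp add: len_def word_of_uminus)

lemma len_add: "len (x + y) \<le> len x + len y"
  using len_of_word[of "word_of x @ word_of y"] by (simp add: of_word_append len_def)

definition letter :: "'a letter \<Rightarrow> 'a fg" where
  "letter x = of_word [x]"

lemma of_word_Cons: "of_word (x # w) = letter x + of_word w"
  using of_word_append[of "[x]" w] by (simp add: letter_def)

lemma letter_inv_letter [simp]: "letter (inv_letter x) = - letter x"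
  using of_word_inv_word[of "[x]"] by (simp add: letter_def)

lemma letter_False: "letter (c, False) = - letter (c, True)"
  using letter_inv_letter[of "(c, True)"] by (simp add: inv_letter_def)

lemma word_of_letter [simp]: "word_of (letter x) = [x]"
  by (simp add: letter_def word_of_of_word reduce_def)

lemma letter_eq_iff [simp]: "letter x = letter y \<longleftrightarrow> x = y"
proof
  assume "letter x = letter y"
  then have "word_of (letter x) = word_of (letter y)" by simp
  then show "x = y" by simp
qed simp

lemma len_letter [simp]: "len (letter x) = 1"
  by (simp add: len_def)

lemma len_eq_1E:
  assumes "len x = 1" obtains y where "x = letter y"
proof -
  from assms obtain y where "word_of x = [y]" by (auto simp: len_def length_Suc_conv)
  then have "x = letter y" using of_word_word_of[of x] by (simp add: letter_def)
  then show ?thesis by (rule that)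
qed

section \<open>Homomorphisms and generated subgroups\<close>

definition additive :: "('a::group_add \<Rightarrow> 'b::group_add) \<Rightarrow> bool" where
  "additive f \<longleftrightarrow> (\<forall>x y. f (x + y) = f x + f y)"

lemma additiveD:
  assumes "additive f"
  shows "f (x + y) = f x + f y" "f 0 = 0" "f (- x) = - f x" "f (x - y) = f x - f y"
proof -
  show add: "f (x + y) = f x + f y" for x y using assms by (simp add: additive_def)
  have "f 0 + f 0 = f 0 + 0" using add[of 0 0] by simp
  then show zero: "f 0 = 0" by (simp only: add_left_cancel)
  show neg: "f (- x) = - f x" for x
    using add[of "- x" x] by (simp add: zero eq_neg_iff_add_eq_0)
  show "f (x - y) = f x - f y"
    using add[of x "- y"] neg[of y] by simp
qed

lemma additive_comp: "additive f \<Longrightarrow> additive g \<Longrightarrow> additive (f \<circ> g)"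
  by (simp add: additive_def)

lemma additive_ext:
  fixes f g :: "'a fg \<Rightarrow> 'b::group_add"
  assumes f: "additive f" and g: "additive g" and eq: "\<And>c. f (letter (c, True)) = g (letter (c, True))"
  shows "f = g"
proof
  fix x
  have letter: "f (letter y) = g (letter y)" for y
    by (cases y; cases "snd y") (auto simp: eq letter_False additiveD[OF f] additiveD[OF g])
  have "f (of_word w) = g (of_word w)" for w
    by (induction w) (simp_all add: of_word_Cons additiveD[OF f] additiveD[OF g] letter)
  from this[of "word_of x"] show "f x = g x" by simp
qed

definition eval_letter :: "('a \<Rightarrow> 'b::group_add) \<Rightarrow> 'a letter \<Rightarrow> 'b" where
  "eval_letter h x = (if snd x then h (fst x) else - h (fst x))"

text \<open>The universal property of the free group.\<close>

definition lift :: "('a \<Rightarrow> 'b::group_add) \<Rightarrow> 'a fg \<Rightarrow> 'b" where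
  "lift h x = sum_list (map (eval_letter h) (word_of x))"

lemma lift_of_word: "lift h (of_word w) = sum_list (map (eval_letter h) w)"
proof -
  have "sum_list (map (eval_letter h) (cancel_cons x w)) = sum_list (map (eval_letter h) (x # w))" for x w
    by (cases w) (auto simp: eval_letter_def inv_letter_def simp flip: add.assoc)
  then have "sum_list (map (eval_letter h) (reduce w)) = sum_list (map (eval_letter h) w)"
    by (induction w) (auto simp: reduce_def)
  then show ?thesis by (simp add: lift_def word_of_of_word)
qed

lemma additive_lift [simp]: "additive (lift h)"
  unfolding additive_def
proof (intro allI)
  fix x y :: "'a fg"
  show "lift h (x + y) = lift h x + lift h y"
    using lift_of_word[of h "word_of x @ word_of y"] by (simp add: of_word_append lift_def)
qed

lemma lift_letter [simp]: "lift h (letter x) = eval_letter h x"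
  by (simp add: lift_def)

definition conj_by :: "'a::group_add \<Rightarrow> 'a \<Rightarrow> 'a" where
  "conj_by g x = g + x - g"

lemma additive_conj_by [simp]: "additive (conj_by g)"
  unfolding additive_def conj_by_def by (simp add: add.assoc[symmetric] add_diff_eq)

lemma conj_by_simps [simp]: "conj_by 0 = id" "conj_by g (conj_by h x) = conj_by (g + h) x"
  by (simp_all add: fun_eq_iff conj_by_def add.assoc[symmetric] add_diff_eq diff_add_eq_diff_diff_swap)

lemma additive_conj_by_swap: "additive f \<Longrightarrow> f (conj_by g x) = conj_by (f g) (f x)"
  by (simp add: conj_by_def additiveD)

text \<open>The subgroup generated by \<open>S\<close>.\<close>

inductive_set sg :: "'a::group_add set \<Rightarrow> 'a set" for S where
  sg_zero: "0 \<in> sg S"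
| sg_plus: "s \<in> S \<Longrightarrow> h \<in> sg S \<Longrightarrow> s + h \<in> sg S"
| sg_minus: "s \<in> S \<Longrightarrow> h \<in> sg S \<Longrightarrow> - s + h \<in> sg S"

lemma sg_base: "s \<in> S \<Longrightarrow> s \<in> sg S"
  using sg_plus[OF _ sg_zero, of s S] by simp

lemma sg_add: "x \<in> sg S \<Longrightarrow> y \<in> sg S \<Longrightarrow> x + y \<in> sg S"
  by (induction rule: sg.induct) (simp_all add: add.assoc sg_plus sg_minus)

lemma sg_uminus: "x \<in> sg S \<Longrightarrow> - x \<in> sg S"
proof (induction rule: sg.induct)
  case (sg_plus s h)
  have "- s \<in> sg S" using sg_minus[OF sg_plus(1) sg_zero] by simp
  from sg_add[OF sg_plus.IH this] show ?case by (simp add: minus_add)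
next
  case (sg_minus s h)
  have "s \<in> sg S" using sg_minus by (simp add: sg_base)
  from sg_add[OF sg_minus.IH this] show ?case by (simp add: minus_add)
qed (simp add: sg_zero)

lemma sg_image_subset:
  assumes "additive f" "f ` S \<subseteq> sg T"
  shows "f ` sg S \<subseteq> sg T"
proof -
  have "f x \<in> sg T" if "x \<in> sg S" for x
    using that
  proof (induction rule: sg.induct)
    case sg_zero
    show ?case by (simp add: additiveD[OF assms(1)] sg.sg_zero)
  next
    case (sg_plus s h)
    then show ?case using assms(2) by (auto simp: additiveD[OF assms(1)] intro: sg_add)
  next
    case (sg_minus s h)
    then show ?case using assms(2)
      by (auto simp: additiveD[OF assms(1)] intro: sg_add sg_uminus)
  qed
  then show ?thesis by auto
qed

section \<open>Nielsen's theorem in rank two\<close>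

lemma len_gt_0_iff [simp]: "0 < len x \<longleftrightarrow> x \<noteq> 0"
  by (metis len_eq_0_iff gr0I less_irrefl)

lemma letter_neq_0 [simp]: "letter x \<noteq> 0"
  using len_eq_0_iff[of "letter x"] by simp

lemma reduced_cancel:
  fixes p q :: "'a word"
  assumes "reduced p" "reduced q"
  shows "\<exists>r s t. p = r @ inv_word t \<and> q = t @ s \<and> reduced (r @ s)"
  using assms
proof (induction "length p" arbitrary: p q)
  case 0
  then show ?case by (intro exI[of _ "[]"] exI[of _ q]) simp
next
  case (Suc n)
  show ?case
  proof (cases "reduced (p @ q)")
    case True
    then show ?thesis by (intro exI[of _ p] exI[of _ q] exI[of _ "[]"]) simp
  next
    case False
    with Suc.prems have "p \<noteq> []" "q \<noteq> []" and hd: "hd q = inv_letter (last p)"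
      by (auto simp: reduced_append)
    then obtain p' x q' where p: "p = p' @ [x]" and q: "q = inv_letter x # q'"
      by (metis append_butlast_last_id list.collapse)
    have "\<exists>r s t. p' = r @ inv_word t \<and> q' = t @ s \<and> reduced (r @ s)"
      using Suc by (intro Suc.hyps(1)) (auto simp: p q reduced_append reduced_Cons)
    then obtain r s t where "p' = r @ inv_word t" "q' = t @ s" "reduced (r @ s)" by blast
    then show ?thesis
      by (intro exI[of _ r] exI[of _ s] exI[of _ "inv_letter x # t"]) (simp add: p q)
  qed
qed

lemma word_of_add_cancel:
  obtains r s t where "word_of x = r @ inv_word t" "word_of y = t @ s" "word_of (x + y) = r @ s"
proof -
  obtain r s t where *: "word_of x = r @ inv_word t" "word_of y = t @ s" "reduced (r @ s)"
    using reduced_cancel[of "word_of x" "word_of y"] by auto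
  have "x + y = of_word (word_of x) + of_word (word_of y)" by simp
  also have "\<dots> = of_word (r @ s)"
    unfolding * of_word_append of_word_inv_word by (simp add: add.assoc[symmetric])
  finally have "word_of (x + y) = r @ s"
    using *(3) by (simp add: word_of_of_word reduce_reduced)
  with * show ?thesis using that by blast
qed

definition cancelled :: "'a fg \<Rightarrow> 'a fg \<Rightarrow> nat" where
  "cancelled x y = (len x + len y - len (x + y)) div 2"

lemma cancelledE:
  obtains r s t where "word_of x = r @ inv_word t" "word_of y = t @ s" "word_of (x + y) = r @ s"
    "length t = cancelled x y"
proof -
  obtain r s t where *: "word_of x = r @ inv_word t" "word_of y = t @ s" "word_of (x + y) = r @ s"
    by (rule word_of_add_cancel)
  then have "length t = cancelled x y" by (simp add: cancelled_def len_def)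
  with * show ?thesis using that by blast
qed

text \<open>If half of \<open>x\<close> or more cancelled in \<open>x + x\<close>, then letters in mirror positions of the word of \<open>x\<close> would
  be inverse to each other. At the middle of the word there would then be a letter
  that is its own inverse, or two adjacent letters that cancel.\<close>

lemma cancelled_self:
  assumes "x \<noteq> 0"
  shows "2 * cancelled x x < len x"
proof (rule ccontr)
  assume *: "\<not> 2 * cancelled x x < len x"
  obtain r s t where rst: "word_of x = r @ inv_word t" "word_of x = t @ s" "length t = cancelled x x"
    by (rule cancelledE[of x x])
  define w n where "w = word_of x" and "n = length w"
  have w: "w \<noteq> []" "reduced w" using assms by (simp_all add: w_def)
  have n: "n \<le> 2 * length t" "length t \<le> n"
    using * rst by (auto simp: len_def n_def w_def)
  have sym: "w ! (n - 1 - i) = inv_letter (w ! i)" if "i < length t" for i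
  proof -
    have "length r + length t = n" using rst(1) by (simp add: n_def w_def)
    then have "n - 1 - i = length r + (length t - 1 - i)" using that by simp
    then have "w ! (n - 1 - i) = inv_word t ! (length t - 1 - i)"
      by (simp only: w_def rst(1) nth_append_length_plus)
    also have "\<dots> = inv_letter (t ! i)"
      using that by (simp add: inv_word_def rev_nth)
    also have "t ! i = w ! i" using that rst(2) by (simp add: w_def nth_append)
    finally show ?thesis .
  qed
  show False
  proof (cases "even n")
    case True
    then obtain k where k: "n = 2 * k" by blast
    with w(1) obtain j where j: "k = Suc j" by (cases k) (auto simp: n_def)
    with k n have "w ! Suc j = inv_letter (w ! j)" using sym[of j] by simp
    moreover have "w ! Suc j \<noteq> inv_letter (w ! j)"
      using w(2) k j unfolding reduced_def successively_conv_nth n_def by simp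
    ultimately show False by simp
  next
    case False
    then obtain k where k: "n = 2 * k + 1" by (metis oddE)
    with n have "w ! k = inv_letter (w ! k)" using sym[of k] by simp
    then show False by simp
  qed
qed

text \<open>The classical property of Nielsen reduced sets. In a product of generators, a factor loses fewer
  letters to its two neighbours together than it has (\<open>N2\<close>), so at least one letter of each factor
  survives. The invariant of the induction keeps the part of the first factor that survives as an
  explicit prefix of the product.\<close>

lemma word_of_nielsen_reduced_image:
  fixes f :: "'b fg \<Rightarrow> 'a fg"
  assumes f: "additive f"
  defines "c \<equiv> \<lambda>x y. cancelled (f (letter x)) (f (letter y))"
  assumes N1: "\<And>x y. y \<noteq> inv_letter x \<Longrightarrow> c x y < len (f (letter x))"
    and N2: "\<And>x y z. y \<noteq> inv_letter x \<Longrightarrow> z \<noteq> inv_letter y \<Longrightarrow> c x y + c y z < len (f (letter y))"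
    and w: "reduced (x # w)"
  shows "\<exists>r. word_of (f (of_word (x # w))) =
      take (len (f (letter x)) - (if w = [] then 0 else c x (hd w))) (word_of (f (letter x))) @ r \<and> length w \<le> length r"
  using w
proof (induction w arbitrary: x)
  case Nil
  then show ?case by (simp add: len_def flip: letter_def)
next
  case (Cons y w)
  define c' where "c' = (if w = [] then 0 else c y (hd w))"
  from Cons.prems have red: "reduced (y # w)" "y \<noteq> inv_letter x" by (auto simp: reduced_Cons)
  have c': "c x y + c' < len (f (letter y))"
    using N2[of y x "hd w"] N2[of y x y] red by (auto simp: c'_def reduced_Cons)
  from Cons.IH[OF red(1)] obtain r where
    r: "word_of (f (of_word (y # w))) = take (len (f (letter y)) - c') (word_of (f (letter y))) @ r" "length w \<le> length r"
    by (auto simp: c'_def)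
  obtain p s t where pst: "word_of (f (letter x)) = p @ inv_word t" "word_of (f (letter y)) = t @ s"
    "word_of (f (letter x) + f (letter y)) = p @ s" "length t = c x y"
    unfolding c_def by (rule cancelledE)
  define s1 where "s1 = take (len (f (letter y)) - c' - c x y) s"
  have s1: "s1 \<noteq> []" using c' pst by (auto simp: s1_def len_def)
  have tail: "word_of (f (of_word (y # w))) = t @ s1 @ r"
    using c' pst unfolding r(1) s1_def by (simp add: diff_commute)
  have "reduced (t @ s1 @ r)" unfolding tail[symmetric] by simp
  then have sr: "reduced (s1 @ r)" by (simp add: reduced_append)
  have "reduced (p @ s)" unfolding pst(3)[symmetric] by simp
  then have "reduced (p @ s1)"
    by (metis append_assoc append_take_drop_id reduced_append s1_def)
  with sr s1 have red': "reduced (p @ s1 @ r)" by (auto simp: reduced_append)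
  have "f (of_word (x # y # w)) = of_word (word_of (f (letter x))) + of_word (word_of (f (of_word (y # w))))"
    by (simp add: of_word_Cons[of x] additiveD[OF f])
  also have "\<dots> = of_word (p @ s1 @ r)"
    unfolding pst(1) tail unfolding of_word_append of_word_inv_word by (simp add: add.assoc[symmetric])
  finally have "word_of (f (of_word (x # y # w))) = p @ s1 @ r"
    using red' by (simp add: word_of_of_word reduce_reduced)
  moreover have "take (len (f (letter x)) - c x y) (word_of (f (letter x))) = p"
    using pst by (simp add: len_def)
  moreover have "length (y # w) \<le> length (s1 @ r)"
    using s1 r(2) by (cases s1) auto
  ultimately show ?case by auto
qed

text \<open>The transvection \<open>x \<mapsto> x z\<close> for letters \<open>x\<close> and \<open>z\<close>, where \<open>x\<close> may be an inverse generator. The case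
  distinction determines the image of the generator from that of \<open>x\<close>.\<close>

definition transv :: "'a letter \<Rightarrow> 'a letter \<Rightarrow> 'a fg \<Rightarrow> 'a fg" where
  "transv x z = lift (\<lambda>c. if c = fst x then (if snd x then letter (c, True) + letter z else - letter z + letter (c, True))
    else letter (c, True))"

lemma additive_transv [simp]: "additive (transv x z)"
  by (simp add: transv_def)

lemma transv_letter:
  "transv x z (letter x) = letter x + letter z"
  "fst y \<noteq> fst x \<Longrightarrow> transv x z (letter y) = letter y"
  by (cases x; cases y; auto simp: transv_def eval_letter_def letter_False minus_add)+

lemma additive_ext_letters:
  fixes f g :: "basis fg \<Rightarrow> 'b::group_add"
  assumes f: "additive f" and g: "additive g" and xz: "fst x \<noteq> fst z"
    and eq: "f (letter x) = g (letter x)" "f (letter z) = g (letter z)"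
  shows "f = g"
proof (rule additive_ext[OF f g])
  fix c
  have inv: "f (letter (inv_letter y)) = g (letter (inv_letter y))" if "f (letter y) = g (letter y)" for y
    using that by (simp add: additiveD[OF f] additiveD[OF g])
  have "(c, True) \<in> {x, inv_letter x, z, inv_letter z}"
    using xz by (cases x; cases z; cases c; cases "fst x"; cases "fst z"; auto simp: inv_letter_def)
  then show "f (letter (c, True)) = g (letter (c, True))"
    using eq inv[OF eq(1)] inv[OF eq(2)] by (auto simp del: letter_inv_letter)
qed

lemma transv_transv:
  assumes "fst (x :: basis letter) \<noteq> fst z"
  shows "transv x z \<circ> transv x (inv_letter z) = id"
proof (rule additive_ext_letters[of _ _ x z])
  show "additive (id :: basis fg \<Rightarrow> basis fg)" by (simp add: additive_def)
  show "additive (transv x z \<circ> transv x (inv_letter z))" by (intro additive_comp additive_transv)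
qed (use assms in \<open>auto simp: transv_letter additiveD[OF additive_transv]\<close>)

lemma bij_transv:
  assumes "fst (x :: basis letter) \<noteq> fst z"
  shows "bij (transv x z)"
  using transv_transv[of x z] transv_transv[of x "inv_letter z"] assms
  by (intro o_bij[of "transv x (inv_letter z)"]) auto

lemma bij_conj_by: "bij (conj_by (g :: 'a::group_add))"
  by (rule o_bij[of "conj_by (- g)"]) (auto simp: fun_eq_iff)

lemma sum_over_basis:
  "fst x \<noteq> fst z \<Longrightarrow> f (letter (A, True)) = f (letter (A, False)) \<Longrightarrow> f (letter (B, True)) = f (letter (B, False)) \<Longrightarrow>
    f (letter (A, True)) + f (letter (B, True)) = f (letter x) + (f (letter z) :: nat)"
  by (cases x; cases z; cases "fst x"; cases "fst z"; cases "snd x"; cases "snd z") auto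

text \<open>Nielsen's theorem for \<open>F\<^sub>2\<close> as an induction principle. The induction is on the total length of the
  images of the basis. If neither a transvection nor a transvection followed by a conjugation
  shortens them, then the images form a Nielsen reduced set, and such a set can only generate the
  letters if it consists of letters.

  The combination with a conjugation replaces the usual tie-breaking order on words. If \<open>N2\<close> fails,
  then the words of the images have the form \<open>x = s\<^sup>-\<^sup>1 m t\<^sup>-\<^sup>1\<close> and \<open>y = t s\<close> with \<open>s\<close> and \<open>t\<close> of equal length;
  conjugating \<open>(x y, y)\<close> by \<open>s\<close> yields the shorter pair \<open>(m, s t)\<close>.\<close>

theorem nielsen_induct [consumes 2, case_names letters transv conj]:
  fixes f :: "basis fg \<Rightarrow> basis fg"
  assumes "additive f" "bij f"
    and letters: "\<And>f x z. additive f \<Longrightarrow> fst x \<noteq> fst z \<Longrightarrow> f (letter (A, True)) = letter x \<Longrightarrow> f (letter (B, True)) = letter z \<Longrightarrow> P f"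
    and transv: "\<And>f x z. additive f \<Longrightarrow> bij f \<Longrightarrow> fst x \<noteq> fst z \<Longrightarrow> P f \<Longrightarrow> P (f \<circ> transv x z)"
    and conj: "\<And>f g. additive f \<Longrightarrow> bij f \<Longrightarrow> P f \<Longrightarrow> P (f \<circ> conj_by g)"
  shows "P f"
  using assms(1,2)
proof (induction "len (f (letter (A, True))) + len (f (letter (B, True)))" arbitrary: f rule: less_induct)
  case less
  note f = \<open>additive f\<close> \<open>bij f\<close>
  define Y where "Y x = f (letter x)" for x
  have Y_inv: "Y (inv_letter x) = - Y x" for x by (simp add: Y_def additiveD[OF f(1)])
  have Y_0: "Y x \<noteq> 0" for x
  proof
    assume "Y x = 0"
    then have "f (letter x) = f 0" by (simp add: Y_def additiveD[OF f(1)])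
    then have "letter x = 0" using f(2) by (simp add: bij_is_inj inj_eq)
    then have "len (letter x) = 0" by simp
    then show False by simp
  qed
  have measure: "len (h (letter (A, True))) + len (h (letter (B, True))) = len (h (letter x)) + len (h (letter z))"
    if "additive h" "fst x \<noteq> fst z" for h :: "basis fg \<Rightarrow> basis fg" and x z
    using that by (intro sum_over_basis[where f = "\<lambda>x. len (h x)"]) (simp_all add: letter_False additiveD)
  show ?case
  proof (cases "\<exists>x z g. fst x \<noteq> fst z \<and> len (conj_by g (Y x + Y z)) + len (conj_by g (Y z)) < len (Y x) + len (Y z)")
    case True
    then obtain x z g where xz: "fst x \<noteq> fst z"
      and letter: "len (conj_by g (Y x + Y z)) + len (conj_by g (Y z)) < len (Y x) + len (Y z)" by blast
    obtain g' where g': "f g' = g" using f(2) by (metis bij_pointE)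
    define h where "h = f \<circ> conj_by g' \<circ> transv x z"
    have h: "additive h" "bij h"
      unfolding h_def using f xz by (auto intro!: additive_comp bij_comp bij_conj_by bij_transv)
    have "h (letter x) = conj_by g (Y x + Y z)" "h (letter z) = conj_by g (Y z)"
      using xz by (simp_all add: h_def transv_letter Y_def g' additive_conj_by_swap[OF f(1)] additiveD[OF f(1)])
    then have "len (h (letter (A, True))) + len (h (letter (B, True))) < len (f (letter (A, True))) + len (f (letter (B, True)))"
      using letter measure[OF h(1) xz] measure[OF f(1) xz] by (simp add: Y_def)
    from less.hyps[OF this h] have "P h" .
    then have "P (h \<circ> transv x (inv_letter z) \<circ> conj_by (- g'))"
      using h xz by (intro transv conj additive_comp bij_comp bij_transv) auto
    also have "h \<circ> transv x (inv_letter z) \<circ> conj_by (- g') = f \<circ> (conj_by g' \<circ> (transv x z \<circ> transv x (inv_letter z)) \<circ> conj_by (- g'))"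
      by (simp add: h_def comp_assoc)
    also have "\<dots> = f" unfolding transv_transv[OF xz] by (simp add: fun_eq_iff)
    finally show ?thesis .
  next
    case False
    then have min: "len (Y x) + len (Y z) \<le> len (conj_by g (Y x + Y z)) + len (conj_by g (Y z))"
      if "fst x \<noteq> fst z" for x z g using that by (meson not_le)
    define c where "c x z = cancelled (Y x) (Y z)" for x z
    have half: "2 * c x z \<le> len (Y x)" "2 * c x z \<le> len (Y z)" if xz: "fst x \<noteq> fst z" for x z
    proof -
      obtain r s t where rst: "word_of (Y x) = r @ inv_word t" "word_of (Y z) = t @ s"
        "word_of (Y x + Y z) = r @ s" "length t = c x z"
        unfolding c_def by (rule cancelledE)
      have "len (Y x) \<le> len (Y x + Y z)" using min[OF xz, of 0] by simp
      moreover have "len (Y z) \<le> len (Y x + Y z)"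
      proof -
        have "len (- Y z) \<le> len (- Y z + - Y x)"
          using min[of "inv_letter z" "inv_letter x" 0] xz by (simp add: Y_inv)
        also have "- Y z + - Y x = - (Y x + Y z)" by (simp add: minus_add)
        finally show ?thesis by (simp only: len_uminus)
      qed
      ultimately show "2 * c x z \<le> len (Y x)" "2 * c x z \<le> len (Y z)"
        using rst by (simp_all add: len_def)
    qed
    have self: "2 * c x x < len (Y x)" for x
      unfolding c_def by (rule cancelled_self[OF Y_0])
    have half': "2 * c x z \<le> len (Y x)" "2 * c x z \<le> len (Y z)" if "z \<noteq> inv_letter x" for x z
      using that half[of x z] self[of x] same_generator_iff[of z x] by fastforce+
    have N2: "c x y + c y z < len (Y y)" if y: "y \<noteq> inv_letter x" and z: "z \<noteq> inv_letter y" for x y z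
    proof (rule ccontr)
      assume "\<not> c x y + c y z < len (Y y)"
      with half'(2)[OF y] half'(1)[OF z] have k: "2 * c x y = len (Y y)" "2 * c y z = len (Y y)"
        by linarith+
      have xy: "fst x \<noteq> fst y"
        using k(1) self[of y] y by (auto simp: same_generator_iff)
      have yz: "fst y \<noteq> fst z"
        using k(2) self[of y] z by (auto simp: same_generator_iff)
      obtain r s t where R: "word_of (Y x) = r @ inv_word t" "word_of (Y y) = t @ s" "length t = c x y"
        unfolding c_def by (rule cancelledE)
      obtain r' s' t' where R': "word_of (Y y) = r' @ inv_word t'" "word_of (Y z) = t' @ s'" "length t' = c y z"
        unfolding c_def by (rule cancelledE)
      have "length r' = length t"
        using R(2,3) R'(1,3) k by (simp add: len_def)
      with R(2) R'(1) have s: "s = inv_word t'" by simp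
      have t: "length t' = length t" "t \<noteq> []"
        using R(3) R'(3) k Y_0[of y] by auto
      have "fst x = fst z" using xy yz by (metis (full_types) basis.exhaust)
      then consider "z = inv_letter x" | "z = x" by (auto simp: same_generator_iff)
      then show False
      proof cases
        case 1
        then have "t' @ s' = t @ inv_word r"
          using R'(2) R(1) by (simp add: Y_inv word_of_uminus)
        with t(1) have "t' = t" by simp
        with s R(2) have "reduced (t @ inv_word t)"
          using reduced_word_of[of "Y y"] by simp
        then have "reduce (t @ inv_word t) = t @ inv_word t" by (rule reduce_reduced)
        with t(2) show False by simp
      next
        case 2
        with R(1) R'(2) have eq: "r @ inv_word t = t' @ s'" by simp
        have "length r \<ge> length t'"
          using half(1)[OF xy] R(1,3) t(1) by (simp add: len_def)
        then obtain m where m: "r = t' @ m"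
          using eq by (metis append_eq_append_conv_if append_take_drop_id)
        define S T M where "S = of_word s" and "T = of_word t" and "M = of_word m"
        have Yx: "Y x = - S + M - T"
          using of_word_word_of[of "Y x"]
          by (simp add: R(1) m of_word_append of_word_inv_word S_def T_def M_def s add_diff_eq)
        have Yy: "Y y = T + S"
          using of_word_word_of[of "Y y"] by (simp add: R(2) of_word_append S_def T_def)
        have "conj_by S (Y x + Y y) = M"
          by (simp add: conj_by_def Yx Yy add.assoc[symmetric] add_diff_eq)
        moreover have "conj_by S (Y y) = S + T"
          by (simp add: conj_by_def Yy add.assoc[symmetric])
        ultimately have "len (Y x) + len (Y y) \<le> len M + len (S + T)"
          using min[OF xy, of S] by simp
        also have "\<dots> \<le> length m + (length s + length t)"
          using len_add[of S T] len_of_word[of s] len_of_word[of t] len_of_word[of m]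
          unfolding S_def T_def M_def by linarith
        also have "length s = length t" using s t(1) by simp
        finally have "len (Y x) + len (Y y) \<le> length m + 2 * length t" by simp
        moreover have "len (Y x) = length m + 2 * length t"
          using R(1) m t(1) by (simp add: len_def)
        moreover have "len (Y y) > 0" using Y_0[of y] by (metis len_eq_0_iff gr0I)
        ultimately show False by linarith
      qed
    qed
    have N1: "c x y < len (Y x)" if "y \<noteq> inv_letter x" for x y
      using half'(1)[OF that] Y_0[of x] by (cases "len (Y x)") auto
    \<comment> \<open>A letter is a product of images, and such a product is at least as long as its number of factors.\<close>
    have letter: "\<exists>x. Y x = letter y" for y
    proof -
      obtain u where u: "f u = letter y" using f(2) by (metis bij_pointE)
      have "u \<noteq> 0" using u len_letter[of y] by (auto simp: additiveD[OF f(1)])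
      then obtain x w where xw: "word_of u = x # w" by (cases "word_of u") auto
      then have "reduced (x # w)" by (metis reduced_word_of)
      from word_of_nielsen_reduced_image[OF f(1) _ _ this] N1 N2 obtain r where
        r: "word_of (f (of_word (x # w))) = take (len (Y x) - (if w = [] then 0 else c x (hd w))) (word_of (Y x)) @ r"
        "length w \<le> length r" unfolding c_def Y_def by blast
      have "len (Y x) - (if w = [] then 0 else c x (hd w)) > 0"
        using N1[of "hd w" x] \<open>reduced (x # w)\<close> Y_0[of x] by (auto simp: reduced_Cons)
      moreover have "word_of (f (of_word (x # w))) = [y]"
        using u by (simp flip: xw)
      then have "length (word_of (f (of_word (x # w)))) = 1" by simp
      then have "len (Y x) - (if w = [] then 0 else c x (hd w)) + length r \<le> 1"
        unfolding r(1) by (simp add: len_def)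
      ultimately have "length w = 0" using r(2) by linarith
      then have "w = []" by simp
      then have "u = letter x" using xw of_word_word_of[of u] by (simp add: letter_def)
      with u have "Y x = letter y" by (simp add: Y_def)
      then show ?thesis by blast
    qed
    from letter[of "(A, True)"] letter[of "(B, True)"] obtain x1 x2
      where x12: "Y x1 = letter (A, True)" "Y x2 = letter (B, True)" by blast
    \<comment> \<open>Both letters of the basis are images of letters, which forces all images to have length one.\<close>
    have "fst x1 \<noteq> fst x2"
    proof
      assume "fst x1 = fst x2"
      then have "Y x1 = Y x2 \<or> Y x1 = Y (inv_letter x2)" by (auto simp: same_generator_iff)
      then have "letter (A, True) = letter (B, True) \<or> letter (A, True) = letter (inv_letter (B, True))"
        by (simp add: x12 Y_inv)
      then show False unfolding letter_eq_iff by (simp add: inv_letter_def)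
    qed
    from measure[OF f(1) this] have "len (Y (A, True)) + len (Y (B, True)) = 2"
      using x12 by (simp add: Y_def)
    moreover have "0 < len (Y (A, True))" "0 < len (Y (B, True))" using Y_0 by simp_all
    ultimately have "len (Y (A, True)) = 1" "len (Y (B, True)) = 1" by linarith+
    then obtain y1 y2 where y12: "Y (A, True) = letter y1" "Y (B, True) = letter y2" by (elim len_eq_1E)
    have "fst y1 \<noteq> fst y2"
    proof
      assume "fst y1 = fst y2"
      then have "y1 = y2 \<or> y1 = inv_letter y2" by (simp only: same_generator_iff)
      then have "Y (A, True) = Y (B, True) \<or> Y (A, True) = Y (inv_letter (B, True))"
        unfolding y12 Y_inv by auto
      then have "letter (A, True) = letter (B, True) \<or> letter (A, True) = letter (inv_letter (B, True))"
        unfolding Y_def inj_eq[OF bij_is_inj[OF f(2)]] .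
      then show False unfolding letter_eq_iff by (simp add: inv_letter_def)
    qed
    from letters[OF f(1) this] y12 show ?thesis by (simp add: Y_def)
  qed
qed

section \<open>The shape of the subgroups\<close>

text \<open>Rewrites group expressions to a normal form that is associated to the left.\<close>

lemmas group_simps = add.assoc[symmetric] add_diff_eq diff_add_eq_diff_diff_swap diff_diff_eq2 minus_add

abbreviation ga :: "basis fg" where "ga \<equiv> letter (A, True)"
abbreviation gb :: "basis fg" where "gb \<equiv> letter (B, True)"

definition sub :: "basis fg \<Rightarrow> basis fg \<Rightarrow> basis fg \<Rightarrow> basis fg" where
  "sub u v = lift (\<lambda>c. case c of A \<Rightarrow> u | B \<Rightarrow> v)"

lemma additive_sub [simp]: "additive (sub u v)"
  by (simp add: sub_def)

lemmas sub_simps [simp] = additiveD[OF additive_sub]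

lemma sub_letter [simp]: "sub u v ga = u" "sub u v gb = v"
  by (simp_all add: sub_def eval_letter_def)

lemma additive_ext_basis:
  fixes f g :: "basis fg \<Rightarrow> 'b::group_add"
  assumes "additive f" "additive g" "f ga = g ga" "f gb = g gb"
  shows "f = g"
proof (rule additive_ext[OF assms(1,2)])
  show "f (letter (c, True)) = g (letter (c, True))" for c
    using assms(3,4) by (cases c) auto
qed

declare additive_comp [simp]

abbreviation perm :: "basis letter \<Rightarrow> basis letter \<Rightarrow> basis fg \<Rightarrow> basis fg" where
  "perm x z \<equiv> sub (letter x) (letter z)"

definition perm_letter :: "basis letter \<Rightarrow> basis letter \<Rightarrow> basis letter \<Rightarrow> basis letter" where
  "perm_letter x z y =
    (let l = (case fst y of A \<Rightarrow> x | B \<Rightarrow> z) in if snd y then l else inv_letter l)"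

lemma perm_of_letter: "perm x z (letter y) = letter (perm_letter x z y)"
  by (cases y; cases "fst y"; cases "snd y") (auto simp: perm_letter_def letter_False)

lemma fst_perm_letter: "fst x \<noteq> fst z \<Longrightarrow> fst u \<noteq> fst v \<Longrightarrow> fst (perm_letter x z u) \<noteq> fst (perm_letter x z v)"
  by (cases "fst u"; cases "fst v") (auto simp: perm_letter_def Let_def)

lemma perm_comp: "perm x z \<circ> perm u v = perm (perm_letter x z u) (perm_letter x z v)"
  by (rule additive_ext_basis) (auto simp: perm_of_letter)

lemma perm_inverse:
  assumes "fst x \<noteq> fst z"
  obtains u v where "fst u \<noteq> fst v" "perm x z \<circ> perm u v = id" "perm u v \<circ> perm x z = id"
proof -
  define u where "u = (if fst x = A then (A, snd x) else (B, snd z))"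
  define v where "v = (if fst x = A then (B, snd z) else (A, snd x))"
  have uv: "fst u \<noteq> fst v" by (auto simp: u_def v_def)
  have id: "perm (A, True) (B, True) = id"
    by (rule additive_ext_basis) (auto simp: additive_def)
  have "perm_letter x z u = (A, True)" "perm_letter x z v = (B, True)"
    "perm_letter u v x = (A, True)" "perm_letter u v z = (B, True)"
    using assms
    by (cases x; cases z; cases "fst x"; cases "fst z"; cases "snd x"; cases "snd z";
        simp add: u_def v_def perm_letter_def inv_letter_def)+
  then show ?thesis using that[OF uv] by (simp add: perm_comp id)
qed

lemma perm_transv:
  assumes "fst x \<noteq> fst z" "fst u \<noteq> fst v"
  shows "perm x z (transv u v h) = transv (perm_letter x z u) (perm_letter x z v) (perm x z h)"
proof -
  have "perm x z \<circ> transv u v = transv (perm_letter x z u) (perm_letter x z v) \<circ> perm x z"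
  proof (rule additive_ext_letters[of _ _ u v])
    show "additive (perm x z \<circ> transv u v)"
      "additive (transv (perm_letter x z u) (perm_letter x z v) \<circ> perm x z)"
      by auto
    show "fst u \<noteq> fst v" by fact
  qed (use assms fst_perm_letter[OF assms] in \<open>auto simp: transv_letter perm_of_letter\<close>)
  then show ?thesis by (auto simp: fun_eq_iff)
qed

text \<open>The substitutions \<open>a \<mapsto> b a\<close> and \<open>b \<mapsto> a b\<close>. Up to inner automorphisms and permutations of the letters
  they generate the automorphisms with positive images.\<close>

definition Lm :: "basis fg \<Rightarrow> basis fg" where "Lm = sub (gb + ga) gb"
definition Rm :: "basis fg \<Rightarrow> basis fg" where "Rm = sub ga (ga + gb)"
definition Linv :: "basis fg \<Rightarrow> basis fg" where "Linv = sub (- gb + ga) gb"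

abbreviation swap :: "basis fg \<Rightarrow> basis fg" where "swap \<equiv> perm (B, True) (A, True)"

fun tau :: "bool list \<Rightarrow> basis fg \<Rightarrow> basis fg" where
  "tau [] h = h"
| "tau (d # ds) h = (if d then Lm else Rm) (tau ds h)"

lemma additive_LR [simp]: "additive Lm" "additive Rm" "additive Linv"
  by (simp_all add: Lm_def Rm_def Linv_def)

lemma additive_id [simp]: "additive id" "additive (\<lambda>x. x)"
  by (simp_all add: additive_def)

lemma additive_tau [simp]: "additive (tau ds)"
proof -
  have "tau ds (x + y) = tau ds x + tau ds y" for x y
    by (induction ds) (simp_all add: additiveD[OF additive_LR(1)] additiveD[OF additive_LR(2)])
  then show ?thesis by (simp add: additive_def)
qed

lemma Lm_Linv [simp]: "Lm (Linv h) = h" "Linv (Lm h) = h"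
proof -
  have "Lm \<circ> Linv = id" "Linv \<circ> Lm = id"
    by (rule additive_ext_basis; auto simp: Lm_def Linv_def group_simps)+
  then show "Lm (Linv h) = h" "Linv (Lm h) = h" by (auto simp: fun_eq_iff)
qed

lemma swap_swap [simp]: "swap (swap h) = h"
proof -
  have "swap \<circ> swap = id" by (rule additive_ext_basis) auto
  then show ?thesis by (auto simp: fun_eq_iff)
qed

lemma swap_tau: "swap (tau ds h) = tau (map Not ds) (swap h)"
proof (induction ds arbitrary: h)
  case (Cons d ds)
  have "swap \<circ> Lm = Rm \<circ> swap" "swap \<circ> Rm = Lm \<circ> swap"
    by (rule additive_ext_basis; auto simp: Lm_def Rm_def)+
  then have "swap (Lm h) = Rm (swap h)" "swap (Rm h) = Lm (swap h)" for h
    by (auto simp: fun_eq_iff)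
  then show ?case by (simp add: Cons)
qed simp

text \<open>\<open>Zgen ds\<close> generates \<open>\<langle>x, x\<^sup>y\<rangle>\<close> for the basis with \<open>x\<close> the image of \<open>a b\<close> and \<open>y\<close> the image of \<open>a\<close> under
  \<open>tau ds\<close>.\<close>

abbreviation Kgen :: "basis fg set" where "Kgen \<equiv> {ga, conj_by (- gb) ga}"
abbreviation Kgen' :: "basis fg set" where "Kgen' \<equiv> {gb, conj_by (- ga) gb}"
definition Zgen :: "bool list \<Rightarrow> basis fg set" where "Zgen ds = {tau ds (ga + gb), tau ds (gb + ga)}"

inductive base :: "basis fg set \<Rightarrow> bool" where
  "base Kgen" | "base Kgen'" | "base (Zgen ds)"

lemma base_swap: "base X \<Longrightarrow> base (swap ` X)"
proof (induction rule: base.induct)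
  case 1
  have "swap ` Kgen = Kgen'" by (simp add: conj_by_def)
  then show ?case by (simp add: base.intros)
next
  case 2
  have "swap ` Kgen' = Kgen" by (simp add: conj_by_def)
  then show ?case by (simp add: base.intros)
next
  case (3 ds)
  have "swap ` Zgen ds = Zgen (map Not ds)" by (auto simp: Zgen_def swap_tau)
  then show ?case by (simp add: base.intros)
qed

text \<open>The inverse of \<open>f\<close> carries each basic subgroup into a basic subgroup, up to conjugation and a
  signed permutation. The elements of \<open>X\<close> are described by their preimages \<open>h\<close>, so that no inverse of
  \<open>f\<close> is mentioned.\<close>

definition straightens :: "(basis fg \<Rightarrow> basis fg) \<Rightarrow> bool" where
  "straightens f \<longleftrightarrow> (\<forall>X. base X \<longrightarrow> (\<exists>x z g X'. fst x \<noteq> fst z \<and> base X' \<and>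
    (\<forall>h. f h \<in> sg X \<longrightarrow> perm x z (conj_by g h) \<in> sg X')))"

lemma straightensD:
  assumes "straightens f" "base X"
  obtains x z g X' where "fst x \<noteq> fst z" "base X'" "\<And>h. f h \<in> sg X \<Longrightarrow> perm x z (conj_by g h) \<in> sg X'"
  using assms unfolding straightens_def by blast

lemma perm_id: "perm (A, True) (B, True) h = h"
proof -
  have "perm (A, True) (B, True) = id" by (rule additive_ext_basis) auto
  then show ?thesis by simp
qed

lemma straighten_by:
  assumes "additive f'" "f' \<circ> f = perm x z \<circ> conj_by g" "f' ` X \<subseteq> sg X'"
    "fst x \<noteq> fst z" "base X'"
  shows "\<exists>x z g X'. fst x \<noteq> fst z \<and> base X' \<and> (\<forall>h. f h \<in> sg X \<longrightarrow> perm x z (conj_by g h) \<in> sg X')"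
proof -
  have "perm x z (conj_by g h) \<in> sg X'" if "f h \<in> sg X" for h
    using sg_image_subset[OF assms(1,3)] that fun_cong[OF assms(2), of h] by auto
  with assms(4,5) show ?thesis by blast
qed

text \<open>Since \<open>Linv\<close> is undone by the positive substitution \<open>Lm\<close>, this only adds a factor to
  \<open>tau ds\<close>, turns \<open>K\<close> into \<open>\<langle>a b, b a\<rangle>\<close>, and fixes \<open>\<langle>b, b\<^sup>a\<rangle>\<close>.\<close>

lemma straightens_Linv: "straightens Linv"
  unfolding straightens_def
proof (intro allI impI)
  fix X assume "base X"
  have triv: "Lm \<circ> Linv = perm (A, True) (B, True) \<circ> conj_by 0" by (simp add: fun_eq_iff perm_id)
  from \<open>base X\<close> show "\<exists>x z g X'. fst x \<noteq> fst z \<and> base X' \<and> (\<forall>h. Linv h \<in> sg X \<longrightarrow> perm x z (conj_by g h) \<in> sg X')"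
  proof cases
    case 1
    show ?thesis
    proof (rule straighten_by[OF _ triv])
      show "Lm ` X \<subseteq> sg (Zgen [])"
        unfolding 1 Zgen_def by (auto simp: Lm_def conj_by_def group_simps intro: sg_base)
    qed (auto intro: base.intros)
  next
    case 2
    show ?thesis
    proof (rule straighten_by[OF _ triv])
      show "Lm ` X \<subseteq> sg Kgen'"
        unfolding 2 by (auto simp: Lm_def conj_by_def group_simps intro: sg_base)
    qed (auto intro: base.intros)
  next
    case (3 ds)
    show ?thesis
    proof (rule straighten_by[OF _ triv])
      show "Lm ` X \<subseteq> sg (Zgen (True # ds))"
        unfolding 3 Zgen_def by (auto intro: sg_base)
    qed (auto intro: base.intros)
  qed
qed

text \<open>Undoing \<open>Lm\<close> removes a factor from \<open>tau ds\<close> if the outermost one is \<open>Lm\<close>. If the outermost one is \<open>Rm\<close>,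
  then \<open>Linv \<circ> Rm\<close> has images of mixed sign. Inverting \<open>b\<close> and conjugating turns it into \<open>Rm \<circ> swap\<close>,
  which is positive again; in terms of slopes, \<open>(p + q, -p)\<close> is reflected to \<open>(p + q, p)\<close>.\<close>

lemma straightens_Lm: "straightens Lm"
  unfolding straightens_def
proof (intro allI impI)
  fix X assume "base X"
  have triv: "Linv \<circ> Lm = perm (A, True) (B, True) \<circ> conj_by 0" by (simp add: fun_eq_iff perm_id)
  define f where "f = perm (A, True) (B, False) \<circ> conj_by gb \<circ> Linv"
  have f: "additive f" by (simp add: f_def)
  have fL: "f \<circ> Lm = perm (A, True) (B, False) \<circ> conj_by gb" by (simp add: f_def fun_eq_iff)
  from \<open>base X\<close> show "\<exists>x z g X'. fst x \<noteq> fst z \<and> base X' \<and> (\<forall>h. Lm h \<in> sg X \<longrightarrow> perm x z (conj_by g h) \<in> sg X')"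
  proof cases
    case 1
    show ?thesis
    proof (rule straighten_by[OF f fL])
      show "f ` X \<subseteq> sg (Zgen [])"
        unfolding 1 Zgen_def
        by (auto simp: f_def Linv_def conj_by_def letter_False group_simps intro: sg_base)
    qed (auto intro: base.intros)
  next
    case 2
    show ?thesis
    proof (rule straighten_by[OF _ triv])
      show "Linv ` X \<subseteq> sg Kgen'"
        unfolding 2 by (auto simp: Linv_def conj_by_def group_simps intro: sg_base)
    qed (auto intro: base.intros)
  next
    case (3 ds)
    consider "ds = []" | ds' where "ds = True # ds'" | ds' where "ds = False # ds'"
      by (metis (full_types) list.exhaust)
    then show ?thesis
    proof cases
      assume ds: "ds = []"
      show ?thesis
      proof (rule straighten_by[OF _ triv])
        show "Linv ` X \<subseteq> sg Kgen"
          unfolding 3 ds Zgen_def by (auto simp: Linv_def conj_by_def group_simps intro: sg_base)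
      qed (auto intro: base.intros)
    next
      fix ds' assume ds: "ds = True # ds'"
      show ?thesis
      proof (rule straighten_by[OF _ triv])
        show "Linv ` X \<subseteq> sg (Zgen ds')"
          unfolding 3 ds Zgen_def by (auto intro: sg_base)
      qed (auto intro: base.intros)
    next
      fix ds' assume ds: "ds = False # ds'"
      have "f \<circ> Rm = Rm \<circ> swap"
        by (rule additive_ext_basis)
          (auto simp: f_def Linv_def Rm_def conj_by_def letter_False group_simps)
      then have fR: "f (Rm h) = Rm (swap h)" for h by (auto simp: fun_eq_iff)
      show ?thesis
      proof (rule straighten_by[OF f fL])
        show "f ` X \<subseteq> sg (Zgen (False # map Not ds'))"
          unfolding 3 ds Zgen_def by (auto simp: fR swap_tau intro: sg_base)
      qed (auto intro: base.intros)
    qed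
  qed
qed

lemma straightens_conj:
  assumes "straightens f"
  shows "straightens (f \<circ> conj_by g0)"
  unfolding straightens_def
proof (intro allI impI)
  fix X assume "base X"
  from assms this obtain x z g X' where *: "fst x \<noteq> fst z" "base X'"
    "\<And>h. f h \<in> sg X \<Longrightarrow> perm x z (conj_by g h) \<in> sg X'"
    by (rule straightensD) blast
  have "perm x z (conj_by (g + g0) h) \<in> sg X'" if "(f \<circ> conj_by g0) h \<in> sg X" for h
    using *(3)[of "conj_by g0 h"] that by simp
  with *(1,2) show "\<exists>x z g X'. fst x \<noteq> fst z \<and> base X' \<and>
      (\<forall>h. (f \<circ> conj_by g0) h \<in> sg X \<longrightarrow> perm x z (conj_by g h) \<in> sg X')"
    by blast
qed

lemma straightens_swap:
  assumes "straightens f"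
  shows "straightens (swap \<circ> f \<circ> swap)"
  unfolding straightens_def
proof (intro allI impI)
  fix X assume "base X"
  then have "base (swap ` X)" by (rule base_swap)
  with assms obtain x z g X' where *: "fst x \<noteq> fst z" "base X'"
    "\<And>h. f h \<in> sg (swap ` X) \<Longrightarrow> perm x z (conj_by g h) \<in> sg X'"
    by (rule straightensD) blast
  have "perm (perm_letter x z (B, True)) (perm_letter x z (A, True)) (conj_by (swap g) h) \<in> sg X'"
    if "(swap \<circ> f \<circ> swap) h \<in> sg X" for h
  proof -
    have "swap ` sg X \<subseteq> sg (swap ` X)"
      by (intro sg_image_subset) (auto intro: sg_base)
    with that have "swap ((swap \<circ> f \<circ> swap) h) \<in> sg (swap ` X)" by blast
    then have "perm x z (conj_by g (swap h)) \<in> sg X'" by (intro *(3)) simp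
    also have "conj_by g (swap h) = swap (conj_by (swap g) h)"
      by (simp only: additive_conj_by_swap[OF additive_sub] swap_swap)
    also have "perm x z (swap (conj_by (swap g) h)) =
        perm (perm_letter x z (B, True)) (perm_letter x z (A, True)) (conj_by (swap g) h)"
      using fun_cong[OF perm_comp[of x z "(B, True)" "(A, True)"]] by simp
    finally show ?thesis .
  qed
  moreover have "fst (perm_letter x z (B, True)) \<noteq> fst (perm_letter x z (A, True))"
    using *(1) by (intro fst_perm_letter) auto
  ultimately show "\<exists>x z g X'. fst x \<noteq> fst z \<and> base X' \<and>
      (\<forall>h. (swap \<circ> f \<circ> swap) h \<in> sg X \<longrightarrow> perm x z (conj_by g h) \<in> sg X')"
    using *(2) by blast
qed

text \<open>Conjugation by \<open>z\<close> moves the new letter to the other side of \<open>x\<close>, and \<open>swap\<close> exchanges the two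
  generators. This leaves \<open>Lm\<close> and \<open>Linv\<close> out of the eight transvections.\<close>

lemma straightens_transv:
  assumes "fst x \<noteq> fst z"
  shows "straightens (transv x z)"
proof -
  have A: "straightens (transv (A, False) z)" if "fst z = B" for z
  proof (cases "snd z")
    case True
    with that have z: "z = (B, True)" by (simp add: prod_eq_iff)
    have "transv (A, False) z = Linv"
      by (rule additive_ext_basis) (auto simp: z transv_def Linv_def eval_letter_def)
    then show ?thesis by (simp add: straightens_Linv)
  next
    case False
    with that have z: "z = (B, False)" by (simp add: prod_eq_iff)
    have "transv (A, False) z = Lm"
      by (rule additive_ext_basis) (auto simp: z transv_def Lm_def eval_letter_def letter_False)
    then show ?thesis by (simp add: straightens_Lm)
  qed
  have neg: "straightens (transv x z)" if "fst x \<noteq> fst z" "\<not> snd x" for x z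
  proof (cases "fst x")
    case A
    with that have "x = (A, False)" "fst z = B" by (cases "fst z"; simp add: prod_eq_iff)+
    with \<open>\<And>z. fst z = B \<Longrightarrow> straightens (transv (A, False) z)\<close> show ?thesis by simp
  next
    case B
    with that have x: "x = (B, False)" and z: "fst z = A" by (cases "fst z"; simp add: prod_eq_iff)+
    have "swap (transv (A, False) (B, snd z) (swap h)) = transv x z h" for h
      using perm_transv[of "(B, True)" "(A, True)" "(A, False)" "(B, snd z)" "swap h"] z
      by (cases z) (simp add: x perm_letter_def inv_letter_def Let_def)
    then have "transv x z = swap \<circ> transv (A, False) (B, snd z) \<circ> swap" by auto
    then show ?thesis using straightens_swap[OF A[of "(B, snd z)"]] by simp
  qed
  show ?thesis
  proof (cases "snd x")
    case False
    with neg assms show ?thesis by blast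
  next
    case True
    have "transv x z = transv (inv_letter x) (inv_letter z) \<circ> conj_by (- letter z)"
    proof (rule additive_ext_letters[of _ _ x z])
      have "transv (inv_letter x) (inv_letter z) (letter x) = - transv (inv_letter x) (inv_letter z) (letter (inv_letter x))"
        unfolding additiveD(3)[OF additive_transv, symmetric] by simp
      then have "transv (inv_letter x) (inv_letter z) (letter x) = letter z + letter x"
        unfolding transv_letter by (simp add: minus_add)
      then show "transv x z (letter x) = (transv (inv_letter x) (inv_letter z) \<circ> conj_by (- letter z)) (letter x)"
        using assms by (simp add: transv_letter conj_by_def additiveD[OF additive_transv] group_simps)
      show "transv x z (letter z) = (transv (inv_letter x) (inv_letter z) \<circ> conj_by (- letter z)) (letter z)"
        using assms by (simp add: transv_letter conj_by_def additiveD[OF additive_transv] group_simps)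
    qed (auto simp: assms)
    moreover have "straightens (transv (inv_letter x) (inv_letter z))"
      using assms True by (intro neg) (auto simp: inv_letter_def)
    ultimately show ?thesis using straightens_conj by simp
  qed
qed

definition normal :: "basis fg set \<Rightarrow> bool" where
  "normal H \<longleftrightarrow> (\<exists>x z g X. fst x \<noteq> fst z \<and> base X \<and> (\<forall>h\<in>H. perm x z (conj_by g h) \<in> sg X))"

lemma normalE:
  assumes "normal H"
  obtains x z g X where "fst x \<noteq> fst z" "base X" "\<And>h. h \<in> H \<Longrightarrow> perm x z (conj_by g h) \<in> sg X"
proof -
  from assms obtain x z g X where *: "fst x \<noteq> fst z" "base X" "\<forall>h\<in>H. perm x z (conj_by g h) \<in> sg X"
    unfolding normal_def by (elim exE conjE)
  show ?thesis by (rule that[OF *(1,2) bspec[OF *(3)]])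
qed

lemma normalI:
  "fst x \<noteq> fst z \<Longrightarrow> base X \<Longrightarrow> (\<And>h. h \<in> H \<Longrightarrow> perm x z (conj_by g h) \<in> sg X) \<Longrightarrow> normal H"
  unfolding normal_def by (intro exI conjI ballI)

lemma normal_if_embeds:
  assumes "additive f" "bij f"
  shows "f ` H \<subseteq> sg Kgen \<Longrightarrow> normal H"
  using assms
proof (induction arbitrary: H rule: nielsen_induct)
  case (letters f x z)
  then have "f = perm x z" by (intro additive_ext_basis) auto
  then have "perm x z (conj_by 0 h) \<in> sg Kgen" if "h \<in> H" for h using letters that by auto
  with letters(2) base.intros(1) show ?case by (rule normalI)
next
  case (transv f x z)
  then have "normal (transv x z ` H)" by (simp add: image_comp)
  then obtain u v g X where uv: "fst u \<noteq> fst v" "base X"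
    and *: "\<And>h. h \<in> transv x z ` H \<Longrightarrow> perm u v (conj_by g h) \<in> sg X"
    by (rule normalE) blast
  obtain g' where g': "transv x z g' = g" using bij_transv[OF transv(3)] by (metis bij_pointE)
  let ?x = "perm_letter u v x" and ?z = "perm_letter u v z"
  have "straightens (transv ?x ?z)"
    using fst_perm_letter[OF uv(1) transv(3)] by (rule straightens_transv)
  from this uv(2) obtain p q k X' where pq: "fst p \<noteq> fst q" "base X'"
    and **: "\<And>h. transv ?x ?z h \<in> sg X \<Longrightarrow> perm p q (conj_by k h) \<in> sg X'"
    by (rule straightensD) blast
  obtain i j where "perm u v \<circ> perm i j = id" by (rule perm_inverse[OF uv(1)])
  then have k': "perm u v (perm i j k) = k" by (auto simp: fun_eq_iff)
  have "perm (perm_letter p q u) (perm_letter p q v) (conj_by (perm i j k + g') h) \<in> sg X'" if "h \<in> H" for h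
  proof -
    have "perm u v (conj_by g (transv x z h)) = transv ?x ?z (perm u v (conj_by g' h))"
      by (simp only: perm_transv[OF uv(1) transv(3), symmetric] additive_conj_by_swap[OF additive_transv] g')
    with *[OF imageI[OF that]] have "perm p q (conj_by k (perm u v (conj_by g' h))) \<in> sg X'"
      by (intro **) simp
    also have "conj_by k (perm u v (conj_by g' h)) = perm u v (conj_by (perm i j k + g') h)"
      by (simp only: conj_by_simps(2)[symmetric] additive_conj_by_swap[OF additive_sub, of _ _ "perm i j k"] k')
    finally show ?thesis by (simp flip: perm_comp)
  qed
  with fst_perm_letter[OF pq(1) uv(1)] pq(2) show ?case by (rule normalI)
next
  case (conj f g0)
  then have "normal (conj_by g0 ` H)" by (simp add: image_comp)
  then obtain x z g X where xz: "fst x \<noteq> fst z" "base X"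
    and *: "\<And>h. h \<in> conj_by g0 ` H \<Longrightarrow> perm x z (conj_by g h) \<in> sg X"
    by (rule normalE) blast
  have "perm x z (conj_by (g + g0) h) \<in> sg X" if "h \<in> H" for h
    using *[OF imageI[OF that]] by simp
  with xz show ?case by (rule normalI)
qed

section \<open>The stem of the normal form\<close>

text \<open>\<open>grow\<close> applies \<open>Lm\<close> or \<open>Rm\<close> to a positive word and appends one letter. It computes \<open>p\<close> from the factors
  of \<open>tau ds\<close>: if \<open>\<tau> (a b) = p a b\<close> and \<open>\<tau> (b a) = p b a\<close>, then applying \<open>a \<mapsto> b a\<close> gives \<open>L(p) b a b\<close> and
  \<open>L(p) b b a\<close>, so that the new stem is \<open>L(p) b\<close>.\<close>

definition positive :: "'a list \<Rightarrow> 'a word" where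
  "positive l = map (\<lambda>c. (c, True)) l"

lemma positive_simps [simp]:
  "positive [] = []" "positive (c # l) = (c, True) # positive l"
  "positive (l @ l') = positive l @ positive l'" "length (positive l) = length l"
  by (simp_all add: positive_def)

fun grow :: "bool \<Rightarrow> basis list \<Rightarrow> basis list" where
  "grow d [] = [if d then B else A]"
| "grow d (A # l) = (if d then [B, A] else [A]) @ grow d l"
| "grow d (B # l) = (if d then [B] else [A, B]) @ grow d l"

fun stem :: "bool list \<Rightarrow> basis list" where
  "stem [] = []"
| "stem (d # ds) = grow d (stem ds)"

text \<open>The length of \<open>p\<close> bounds the number of factors of \<open>tau ds\<close>.\<close>

lemma length_stem: "length ds \<le> length (stem ds)"
proof (induction ds)
  case (Cons d ds)
  have "length l < length (grow d l)" for l
    by (induction d l rule: grow.induct) auto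
  from this[of "stem ds"] Cons show ?case by simp
qed simp

definition stem_gens :: "basis list \<Rightarrow> basis fg set" where
  "stem_gens l = {of_word (positive l @ [(A, True), (B, True)]), of_word (positive l @ [(B, True), (A, True)])}"

lemma Zgen_eq_stem_gens: "Zgen ds = stem_gens (stem ds)"
proof -
  have grow: "(if d then Lm else Rm) (of_word (positive l)) + (if d then gb else ga) = of_word (positive (grow d l))" for d l
  proof (induction d l rule: grow.induct)
    case (1 d)
    show ?case by (simp add: of_word_Cons additiveD)
  next
    case (2 d l)
    then show ?case by (cases d) (simp_all add: of_word_Cons additiveD Lm_def Rm_def add.assoc)
  next
    case (3 d l)
    then show ?case by (cases d) (simp_all add: of_word_Cons additiveD Lm_def Rm_def add.assoc)
  qed
  have "tau ds (ga + gb) = of_word (positive (stem ds)) + ga + gb \<and>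
      tau ds (gb + ga) = of_word (positive (stem ds)) + gb + ga"
  proof (induction ds)
    case (Cons d ds)
    from Cons show ?case
      by (cases d) (simp_all add: grow[symmetric] Lm_def Rm_def add.assoc)
  qed simp
  then show ?thesis
    by (simp add: Zgen_def stem_gens_def of_word_append of_word_Cons add.assoc)
qed

section \<open>Folded graphs\<close>

text \<open>\<open>E u c v\<close> is an edge from \<open>u\<close> to \<open>v\<close> with label \<open>c\<close>; an inverse letter traverses it backwards.\<close>

definition step :: "('v \<Rightarrow> 'a \<Rightarrow> 'v \<Rightarrow> bool) \<Rightarrow> 'v \<Rightarrow> 'a letter \<Rightarrow> 'v \<Rightarrow> bool" where
  "step E u x v \<longleftrightarrow> (if snd x then E u (fst x) v else E v (fst x) u)"

primrec path :: "('v \<Rightarrow> 'a \<Rightarrow> 'v \<Rightarrow> bool) \<Rightarrow> 'v \<Rightarrow> 'a word \<Rightarrow> 'v \<Rightarrow> bool" where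
  "path E u [] v \<longleftrightarrow> u = v"
| "path E u (x # w) v \<longleftrightarrow> (\<exists>m. step E u x m \<and> path E m w v)"

text \<open>Folded in the sense of Stallings, which makes reduction of words preserve the end points of paths.\<close>

definition folded :: "('v \<Rightarrow> 'a \<Rightarrow> 'v \<Rightarrow> bool) \<Rightarrow> bool" where
  "folded E \<longleftrightarrow> (\<forall>u c v v'. E u c v \<longrightarrow> E u c v' \<longrightarrow> v = v') \<and> (\<forall>u u' c v. E u c v \<longrightarrow> E u' c v \<longrightarrow> u = u')"

lemma step_inv_letter: "step E u (inv_letter x) v \<longleftrightarrow> step E v x u"
  by (simp add: step_def inv_letter_def)

lemma path_append: "path E u (w @ w') v \<longleftrightarrow> (\<exists>m. path E u w m \<and> path E m w' v)"
  by (induction w arbitrary: u) auto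

lemma path_inv_word: "path E u (inv_word w) v \<longleftrightarrow> path E v w u"
  by (induction w arbitrary: v) (auto simp: path_append step_inv_letter)

lemma folded_step: "folded E \<Longrightarrow> step E u x v \<Longrightarrow> step E u x v' \<Longrightarrow> v = v'"
  unfolding folded_def step_def by (auto split: if_splits)

lemma path_reduce:
  assumes "folded E" "path E u w v"
  shows "path E u (reduce w) v"
  using assms(2)
proof (induction w arbitrary: u)
  case (Cons x w)
  then obtain m where m: "step E u x m" "path E m (reduce w) v" by auto
  show ?case
  proof (cases "reduce w")
    case Nil
    with m show ?thesis by (auto simp: reduce_def)
  next
    case (Cons y w')
    show ?thesis
    proof (cases "y = inv_letter x")
      case True
      with m Cons obtain m' where "step E m (inv_letter x) m'" "path E m' w' v" by auto
      moreover have "step E m (inv_letter x) u" using m(1) by (simp add: step_inv_letter)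
      ultimately have "path E u w' v" using folded_step[OF assms(1)] by metis
      with Cons True show ?thesis by (simp add: reduce_def)
    next
      case False
      with m Cons show ?thesis by (auto simp: reduce_def)
    qed
  qed
qed (simp add: reduce_def)

lemma path_word_of: "folded E \<Longrightarrow> path E u w v \<Longrightarrow> path E u (word_of (of_word w)) v"
  by (simp add: word_of_of_word path_reduce)

lemma path_word_of_add:
  assumes "folded E" "path E u (word_of x) v" "path E v (word_of y) t"
  shows "path E u (word_of (x + y)) t"
proof -
  have "path E u (word_of x @ word_of y) t" using assms by (auto simp: path_append)
  from path_word_of[OF assms(1) this] show ?thesis by (simp add: of_word_append)
qed

lemma path_word_of_uminus: "path E u (word_of (- x)) v \<longleftrightarrow> path E v (word_of x) u"
  by (simp add: word_of_uminus path_inv_word)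

lemma path_sg:
  assumes E: "folded E" and S: "\<And>s. s \<in> S \<Longrightarrow> path E v (word_of s) v" and h: "h \<in> sg S"
  shows "path E v (word_of h) v"
  using h
proof (induction rule: sg.induct)
  case (sg_plus s h)
  with E S show ?case by (intro path_word_of_add) auto
next
  case (sg_minus s h)
  with E S show ?case by (intro path_word_of_add[OF E]) (auto simp: path_word_of_uminus)
qed simp

text \<open>If the labels \<open>q\<close> of the vertices make every edge trivial modulo the subgroup, then every loop
  represents an element of the subgroup, after conjugation by the label of its base point. Labels
  are only required to work on the edges that are met. The predicate \<open>P u m\<close> says where a path with
  \<open>m\<close> letters left to read can be.\<close>

lemma path_potential:
  assumes step: "\<And>u x u' m. P u (Suc m) \<Longrightarrow> step E u x u' \<Longrightarrow> P u' m \<and> q u + letter x - q u' \<in> sg S"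
    and "P u (length w)" "path E u w v"
  shows "q u + of_word w - q v \<in> sg S"
  using assms(2,3)
proof (induction w arbitrary: u)
  case Nil
  then show ?case by (simp add: sg_zero)
next
  case (Cons x w)
  then obtain m where m: "step E u x m" "path E m w v" by auto
  from step[of u "length w" x m] Cons.prems m(1)
  have *: "P m (length w)" "q u + letter x - q m \<in> sg S" by auto
  from sg_add[OF *(2) Cons.IH[OF *(1) m(2)]] show ?case
    by (simp add: of_word_Cons group_simps)
qed

text \<open>Among all conjugators and base points take a shortest conjugator \<open>g\<close>. No edge at \<open>v\<close> carries the
  first letter of \<open>g\<close>, since otherwise moving \<open>v\<close> along this edge would shorten \<open>g\<close>. Hence nothing cancels
  when the conjugation is undone: \<open>h\<close> consists of a loop at \<open>v\<close>, preceded by the inverse of \<open>g\<close> and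
  followed by \<open>g\<close>.\<close>

lemma short_conjugator:
  assumes E: "folded E" and H: "\<forall>h\<in>H. len h \<le> L" "\<exists>h\<in>H. h \<noteq> 0"
    and ex: "\<forall>h\<in>H. path E v0 (word_of (conj_by g0 h)) v0"
  obtains g v where "2 * len g \<le> L"
    "\<forall>h\<in>H. path E v (word_of (conj_by g h)) v \<and> len (conj_by g h) \<le> L"
proof -
  define Q where "Q g v \<longleftrightarrow> (\<forall>h\<in>H. path E v (word_of (conj_by g h)) v)" for g v
  have "\<exists>g v. Q g v" using ex unfolding Q_def by blast
  then obtain g where "\<exists>v. Q g v" and min: "\<And>g'. \<exists>v. Q g' v \<Longrightarrow> len g \<le> len g'"
    using ex_has_least_nat[of "\<lambda>g. \<exists>v. Q g v" _ len] by blast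
  then obtain v where v: "Q g v" by blast
  \<comment> \<open>A neighbour of \<open>v\<close> along the first letter of \<open>g\<close> would admit the shorter conjugator \<open>w\<close>.\<close>
  have no_step: "\<not> step E v x u" if w: "word_of g = x # w" for x w u
  proof
    assume s: "step E v x u"
    have g: "g = letter x + of_word w" using of_word_word_of[of g] by (simp add: w of_word_Cons)
    have "Q (of_word w) u" unfolding Q_def
    proof
      fix h assume "h \<in> H"
      then have "path E v (word_of (conj_by g h)) v" using v by (simp add: Q_def)
      then have "path E u (inv_letter x # word_of (conj_by g h) @ [x]) u"
        using s by (auto simp: path_append step_inv_letter)
      from path_word_of[OF E this] show "path E u (word_of (conj_by (of_word w) h)) u"
        by (simp add: of_word_Cons of_word_append g conj_by_def group_simps)
    qed
    then have "len g \<le> len (of_word w)" by (intro min) blast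
    also have "\<dots> \<le> length w" by (rule len_of_word)
    finally show False by (simp add: len_def w)
  qed
  have len: "len h = 2 * len g + len (conj_by g h)" if h: "h \<in> H" "h \<noteq> 0" for h
  proof -
    define k where "k = conj_by g h"
    have hk: "h = - g + k + g" by (simp add: k_def conj_by_def group_simps)
    have k: "path E v (word_of k) v" using v h by (simp add: Q_def k_def)
    have "k \<noteq> 0" using h(2) hk by auto
    have "reduced (inv_word (word_of g) @ word_of k @ word_of g)"
    proof (cases "word_of g")
      case (Cons x w)
      have "hd (word_of k) \<noteq> x"
      proof
        assume "hd (word_of k) = x"
        then obtain k' where "word_of k = x # k'"
          using \<open>k \<noteq> 0\<close> by (metis list.collapse word_of_eq_Nil_iff)
        with k show False using no_step[OF Cons] by auto
      qed
      moreover have "last (word_of k) \<noteq> inv_letter x"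
      proof
        assume "last (word_of k) = inv_letter x"
        then obtain k' where "word_of k = k' @ [inv_letter x]"
          using \<open>k \<noteq> 0\<close> by (metis append_butlast_last_id word_of_eq_Nil_iff)
        with k show False using no_step[OF Cons] by (auto simp: path_append step_inv_letter)
      qed
      moreover have "reduced (x # w)" by (metis Cons reduced_word_of)
      moreover have "x \<noteq> inv_letter (last (word_of k))"
        using \<open>last (word_of k) \<noteq> inv_letter x\<close> by auto
      moreover have "reduced (inv_word w @ [inv_letter x])"
        using reduced_inv_word[of "x # w"] \<open>reduced (x # w)\<close> by simp
      ultimately have "reduced ((inv_word w @ [inv_letter x]) @ (word_of k @ (x # w)))"
        using \<open>k \<noteq> 0\<close>
        unfolding reduced_append[of "inv_word w @ [inv_letter x]"] reduced_append[of "word_of k"] by simp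
      then show ?thesis by (simp add: Cons)
    qed simp
    then have "word_of h = inv_word (word_of g) @ word_of k @ word_of g"
      by (rule word_of_eqI) (simp add: of_word_append of_word_inv_word hk add.assoc)
    then show ?thesis by (simp add: len_def k_def)
  qed
  show ?thesis
  proof (rule that)
    from H(2) obtain h where "h \<in> H" "h \<noteq> 0" by blast
    with len[of h] H(1) show "2 * len g \<le> L" by fastforce
    show "\<forall>h\<in>H. path E v (word_of (conj_by g h)) v \<and> len (conj_by g h) \<le> L"
    proof
      fix h assume h: "h \<in> H"
      have "len (conj_by g h) \<le> len h"
        using len[OF h] by (cases "h = 0") (simp_all add: additiveD[OF additive_conj_by])
      with v H(1) h show "path E v (word_of (conj_by g h)) v \<and> len (conj_by g h) \<le> L"
        by (auto simp: Q_def)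
    qed
  qed
qed

section \<open>Theta graphs\<close>

text \<open>The folded graph of \<open>\<langle>p a b, p b a\<rangle>\<close> for \<open>p = l\<close> with \<open>n\<close> letters. The vertices \<open>0, \<dots>, n\<close> lie on the long
  arc; \<open>n + 1\<close> and \<open>n + 2\<close> are the inner vertices of the two short arcs from \<open>n\<close> back to \<open>0\<close>.\<close>

definition theta :: "basis list \<Rightarrow> nat \<Rightarrow> basis \<Rightarrow> nat \<Rightarrow> bool" where
  "theta l u c v \<longleftrightarrow> u < length l \<and> c = l ! u \<and> v = Suc u
     \<or> u = length l \<and> c = A \<and> v = length l + 1 \<or> u = length l + 1 \<and> c = B \<and> v = 0
     \<or> u = length l \<and> c = B \<and> v = length l + 2 \<or> u = length l + 2 \<and> c = A \<and> v = 0"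

lemma folded_theta: "folded (theta l)"
  unfolding folded_def theta_def by auto

lemma path_theta_stem: "i \<le> length l \<Longrightarrow> path (theta l) 0 (positive (take i l)) i"
proof (induction i)
  case (Suc i)
  then have "path (theta l) 0 (positive (take i l)) i" by simp
  moreover have "theta l i (l ! i) (Suc i)" using Suc by (simp add: theta_def)
  ultimately show ?case using Suc
    by (auto simp: take_Suc_conv_app_nth path_append step_def)
qed simp

text \<open>The label of \<open>u\<close> is read along a path from \<open>0\<close> to \<open>u\<close> in a spanning tree.\<close>

definition theta_label :: "basis list \<Rightarrow> nat \<Rightarrow> basis fg" where
  "theta_label l u = (if u \<le> length l then of_word (positive (take u l))
     else of_word (positive l @ [(if u = length l + 1 then A else B, True)]))"

lemma len_theta_label: "len (theta_label l u) \<le> length l + 1"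
  unfolding theta_label_def
  by (auto intro!: order_trans[OF len_of_word])

lemma signed_step:
  assumes "\<And>c. E u c v \<Longrightarrow> q u + letter (c, True) - q v \<in> sg S"
    and "\<And>c. E v c u \<Longrightarrow> q v + letter (c, True) - q u \<in> sg S"
    and "step E u x v"
  shows "q u + letter x - q v \<in> sg S"
proof (cases "snd x")
  case True
  then have "x = (fst x, True)" by (simp add: prod_eq_iff)
  moreover from True assms(3) have "E u (fst x) v" by (simp add: step_def)
  then have "q u + letter (fst x, True) - q v \<in> sg S" by (rule assms(1))
  ultimately show ?thesis by simp
next
  case False
  then have x: "x = (fst x, False)" by (simp add: prod_eq_iff)
  from False assms(3) have "E v (fst x) u" by (simp add: step_def)
  then have "q v + letter (fst x, True) - q u \<in> sg S" by (rule assms(2))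
  from sg_uminus[OF this] have "q u - letter (fst x, True) - q v \<in> sg S"
    by (simp add: group_simps)
  then show ?thesis by (subst x) (simp add: letter_False)
qed

lemma theta_label_edge: "theta l u c v \<Longrightarrow> theta_label l u + letter (c, True) - theta_label l v \<in> sg (stem_gens l)"
  unfolding theta_def
proof (elim disjE conjE)
  assume "u < length l" "c = l ! u" "v = Suc u"
  then have "theta_label l u + letter (c, True) - theta_label l v = 0"
    by (simp add: theta_label_def take_Suc_conv_app_nth of_word_append letter_def)
  then show ?thesis by (simp add: sg_zero)
next
  assume "u = length l + 1" "c = B" "v = 0"
  then have "theta_label l u + letter (c, True) - theta_label l v = of_word (positive l @ [(A, True), (B, True)])"
    by (simp add: theta_label_def of_word_append of_word_Cons add.assoc)
  then show ?thesis by (simp add: stem_gens_def sg_base)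
next
  assume "u = length l + 2" "c = A" "v = 0"
  then have "theta_label l u + letter (c, True) - theta_label l v = of_word (positive l @ [(B, True), (A, True)])"
    by (simp add: theta_label_def of_word_append of_word_Cons add.assoc)
  then show ?thesis by (simp add: stem_gens_def sg_base)
qed (simp_all add: theta_label_def of_word_append of_word_Cons sg_zero)

lemma theta_label_path:
  "path (theta l) u w v \<Longrightarrow> theta_label l u + of_word w - theta_label l v \<in> sg (stem_gens l)"
  by (rule path_potential[where P = "\<lambda>_ _. True"]) (auto intro: signed_step theta_label_edge)

text \<open>The loops at \<open>0\<close> contain the generators and, since the graph is folded, are closed under the group
  operations; conversely the labels show that every loop represents an element of the subgroup.\<close>

lemma sg_stem_gens_iff: "h \<in> sg (stem_gens l) \<longleftrightarrow> path (theta l) 0 (word_of h) 0"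
proof
  have n: "path (theta l) 0 (positive l) (length l)"
    using path_theta_stem[of "length l" l] by simp
  have "theta l (length l) A (length l + 1)" "theta l (length l + 1) B 0"
    "theta l (length l) B (length l + 2)" "theta l (length l + 2) A 0"
    by (simp_all add: theta_def)
  with n have "path (theta l) 0 (positive l @ [(A, True), (B, True)]) 0"
    "path (theta l) 0 (positive l @ [(B, True), (A, True)]) 0"
    by (auto simp: path_append step_def)
  then have "path (theta l) 0 (word_of s) 0" if "s \<in> stem_gens l" for s
    using that path_word_of[OF folded_theta] by (auto simp: stem_gens_def)
  then show "h \<in> sg (stem_gens l) \<Longrightarrow> path (theta l) 0 (word_of h) 0"
    by (rule path_sg[OF folded_theta])
next
  assume "path (theta l) 0 (word_of h) 0"
  from theta_label_path[OF this] show "h \<in> sg (stem_gens l)" by (simp add: theta_label_def)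
qed

text \<open>Labels for the graph without the edge from \<open>j\<close> to \<open>j + 1\<close> of the long arc. What remains of the arc
  consists of two hairs, at \<open>0\<close> and at \<open>n\<close>. These two vertices get the trivial label, and a vertex on a
  hair is labelled from the end of the hair where it is attached. Then all edges become
  trivial modulo \<open>\<langle>a b, b a\<rangle>\<close>.\<close>

definition cut_label :: "basis list \<Rightarrow> nat \<Rightarrow> nat \<Rightarrow> basis fg" where
  "cut_label l j u = (if u \<le> j then of_word (positive (take u l))
     else if u \<le> length l then - of_word (positive (drop u l))
     else letter (if u = length l + 1 then A else B, True))"

lemma cut_label_edge:
  assumes j: "j < length l" and e: "theta l u c v" "u \<noteq> j \<or> v \<noteq> Suc j"
  shows "cut_label l j u + letter (c, True) - cut_label l j v \<in> sg (stem_gens [])"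
  using e(1) unfolding theta_def
proof (elim disjE conjE)
  assume *: "u < length l" "c = l ! u" "v = Suc u"
  with e(2) consider "v \<le> j" | "j < u" by force
  then have "cut_label l j u + letter (c, True) - cut_label l j v = 0"
  proof cases
    case 1
    with * show ?thesis
      by (simp add: cut_label_def take_Suc_conv_app_nth of_word_append letter_def)
  next
    case 2
    have "positive (drop u l) = (c, True) # positive (drop v l)"
      using * by (simp add: Cons_nth_drop_Suc[symmetric])
    with * 2 show ?thesis
      by (simp add: cut_label_def of_word_Cons group_simps)
  qed
  then show ?thesis by (simp add: sg_zero)
next
  assume "u = length l + 1" "c = B" "v = 0"
  then have "cut_label l j u + letter (c, True) - cut_label l j v = of_word (positive [] @ [(A, True), (B, True)])"
    using j by (simp add: cut_label_def of_word_Cons)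
  then show ?thesis by (simp add: stem_gens_def sg_base)
next
  assume "u = length l + 2" "c = A" "v = 0"
  then have "cut_label l j u + letter (c, True) - cut_label l j v = of_word (positive [] @ [(B, True), (A, True)])"
    using j by (simp add: cut_label_def of_word_Cons)
  then show ?thesis by (simp add: stem_gens_def sg_base)
qed (use j in \<open>simp_all add: cut_label_def sg_zero\<close>)

text \<open>The distance from the nearer end of the long arc. Truncated subtraction gives the inner vertices of
  the short arcs the depth \<open>0\<close>.\<close>

definition depth :: "basis list \<Rightarrow> nat \<Rightarrow> nat" where
  "depth l u = min u (length l - u)"

lemma depth_step: "step (theta l) u x v \<Longrightarrow> depth l u \<le> depth l v + 1 \<and> depth l v \<le> depth l u + 1"
  unfolding step_def theta_def depth_def by (auto split: if_splits)

text \<open>A loop of length at most \<open>L\<close> at a vertex of depth greater than \<open>L\<close> never reaches vertex \<open>0\<close>, so the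
  first edge of the long arc can be cut. At a vertex of depth at most \<open>L\<close> it stays at depth at most
  \<open>2 L\<close>, so an edge in the middle of the arc can be cut.\<close>

lemma cut_label_loops:
  assumes l: "4 * L + 4 \<le> length l"
  obtains q where "\<forall>w. length w \<le> L \<longrightarrow> path (theta l) v w v \<longrightarrow> q + of_word w - q \<in> sg (stem_gens [])"
proof -
  have cut: "cut_label l j u + letter x - cut_label l j u' \<in> sg (stem_gens [])"
    if "step (theta l) u x u'" "j < length l" "u \<noteq> j" "u' \<noteq> j" for j u x u'
  proof (rule signed_step[where E = "theta l" and q = "cut_label l j", OF _ _ that(1)])
    show "cut_label l j u + letter (c, True) - cut_label l j u' \<in> sg (stem_gens [])"
      if "theta l u c u'" for c
      using that \<open>u \<noteq> j\<close> by (intro cut_label_edge[OF \<open>j < length l\<close>]) simp_all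
    show "cut_label l j u' + letter (c, True) - cut_label l j u \<in> sg (stem_gens [])"
      if "theta l u' c u" for c
      using that \<open>u' \<noteq> j\<close> by (intro cut_label_edge[OF \<open>j < length l\<close>]) simp_all
  qed
  show ?thesis
  proof (cases "depth l v \<le> L")
    case True
    let ?j = "length l div 2"
    have j: "?j < length l" "2 * L < depth l ?j" using l by (auto simp: depth_def)
    show ?thesis
    proof (rule that, intro allI impI)
      fix w assume w: "length w \<le> L" "path (theta l) v w v"
      show "cut_label l ?j v + of_word w - cut_label l ?j v \<in> sg (stem_gens [])"
      proof (rule path_potential[where P = "\<lambda>u m. depth l u + m \<le> 2 * L" and E = "theta l"])
        fix u x u' m assume *: "depth l u + Suc m \<le> 2 * L" "step (theta l) u x u'"
        then have d: "depth l u' + m \<le> 2 * L" using depth_step[OF *(2)] by simp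
        have "u \<noteq> ?j" "u' \<noteq> ?j" using * d j(2) by auto
        with d cut[OF *(2) j(1)] show "depth l u' + m \<le> 2 * L \<and>
          cut_label l ?j u + letter x - cut_label l ?j u' \<in> sg (stem_gens [])" by simp
      qed (use w True in auto)
    qed
  next
    case False
    have j: "0 < length l" "depth l 0 = 0" using l by (auto simp: depth_def)
    show ?thesis
    proof (rule that, intro allI impI)
      fix w assume w: "length w \<le> L" "path (theta l) v w v"
      show "cut_label l 0 v + of_word w - cut_label l 0 v \<in> sg (stem_gens [])"
      proof (rule path_potential[where P = "\<lambda>u m. m < depth l u" and E = "theta l"])
        fix u x u' m assume *: "Suc m < depth l u" "step (theta l) u x u'"
        then have d: "m < depth l u'" using depth_step[OF *(2)] by simp
        have "u \<noteq> 0" "u' \<noteq> 0" using * d j(2) by (metis less_nat_zero_code)+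
        with d cut[OF *(2) j(1)] show "m < depth l u' \<and>
          cut_label l 0 u + letter x - cut_label l 0 u' \<in> sg (stem_gens [])" by simp
      qed (use w False in auto)
    qed
  qed
qed

lemma bounded_conjugator:
  assumes H: "\<forall>h\<in>H. len h \<le> L" "\<exists>h\<in>H. h \<noteq> 0"
    and g: "\<forall>h\<in>H. conj_by g h \<in> sg (stem_gens l)" and l: "length l \<le> 4 * L + 4"
  obtains g' where "len g' \<le> 5 * L + 5" "\<forall>h\<in>H. conj_by g' h \<in> sg (stem_gens l)"
proof -
  have "\<forall>h\<in>H. path (theta l) 0 (word_of (conj_by g h)) 0"
    using g by (simp add: sg_stem_gens_iff)
  with folded_theta H obtain k v where k: "2 * len k \<le> L"
    "\<forall>h\<in>H. path (theta l) v (word_of (conj_by k h)) v \<and> len (conj_by k h) \<le> L"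
    by (rule short_conjugator)
  show ?thesis
  proof (rule that)
    show "len (theta_label l v + k) \<le> 5 * L + 5"
      using len_add[of "theta_label l v" k] len_theta_label[of l v] k(1) l by linarith
    show "\<forall>h\<in>H. conj_by (theta_label l v + k) h \<in> sg (stem_gens l)"
    proof
      fix h assume "h \<in> H"
      with k(2) have "path (theta l) v (word_of (conj_by k h)) v" by blast
      from theta_label_path[OF this] show "conj_by (theta_label l v + k) h \<in> sg (stem_gens l)"
        unfolding conj_by_simps(2)[symmetric] conj_by_def[of "theta_label l v"] by simp
    qed
  qed
qed

text \<open>If the stem is too long, cutting an edge shows that the stem can be taken to be empty. The
  conjugator that results from the cut may be long, but the empty stem is short enough for
  \<open>bounded_conjugator\<close>.\<close>

lemma bounded_normal_form:
  assumes H: "\<forall>h\<in>H. len h \<le> L" and g: "\<forall>h\<in>H. conj_by g h \<in> sg (Zgen ds)"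
  obtains g' ds' where "len g' \<le> 5 * L + 5" "length ds' \<le> 4 * L + 4"
    "\<forall>h\<in>H. conj_by g' h \<in> sg (Zgen ds')"
proof (cases "\<exists>h\<in>H. h \<noteq> 0")
  case False
  then have "\<forall>h\<in>H. conj_by 0 h \<in> sg (Zgen [])" by (auto simp: sg_zero)
  then show ?thesis using that[of 0 "[]"] by simp
next
  case True
  let ?l = "stem ds"
  have g': "\<forall>h\<in>H. conj_by g h \<in> sg (stem_gens ?l)"
    using g by (simp add: Zgen_eq_stem_gens)
  show ?thesis
  proof (cases "length ?l \<le> 4 * L + 4")
    case l: True
    from H True g' l obtain g' where
      "len g' \<le> 5 * L + 5" "\<forall>h\<in>H. conj_by g' h \<in> sg (stem_gens ?l)"
      by (rule bounded_conjugator)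
    with that[of g' ds] length_stem[of ds] l show ?thesis by (simp add: Zgen_eq_stem_gens)
  next
    case l: False
    have "\<forall>h\<in>H. path (theta ?l) 0 (word_of (conj_by g h)) 0"
      using g' by (simp add: sg_stem_gens_iff)
    with folded_theta H True obtain k v where "2 * len k \<le> L" and k:
      "\<forall>h\<in>H. path (theta ?l) v (word_of (conj_by k h)) v \<and> len (conj_by k h) \<le> L"
      by (rule short_conjugator)
    have "4 * L + 4 \<le> length ?l" using l by simp
    then obtain q where
      q: "\<forall>w. length w \<le> L \<longrightarrow> path (theta ?l) v w v \<longrightarrow> q + of_word w - q \<in> sg (stem_gens [])"
      by (rule cut_label_loops[of L ?l v])
    have "\<forall>h\<in>H. conj_by (q + k) h \<in> sg (stem_gens [])"
    proof
      fix h assume "h \<in> H"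
      with k have "path (theta ?l) v (word_of (conj_by k h)) v" "length (word_of (conj_by k h)) \<le> L"
        by (auto simp: len_def)
      with q show "conj_by (q + k) h \<in> sg (stem_gens [])"
        unfolding conj_by_simps(2)[symmetric] conj_by_def[of q] by fastforce
    qed
    moreover have "length [] \<le> 4 * L + 4" by simp
    ultimately obtain g' where
      "len g' \<le> 5 * L + 5" "\<forall>h\<in>H. conj_by g' h \<in> sg (stem_gens [])"
      by (rule bounded_conjugator[OF H True])
    with that[of g' "[]"] show ?thesis by (simp add: Zgen_eq_stem_gens)
  qed
qed

section \<open>Automorphisms as products of moves\<close>

text \<open>Moves \<open>0\<close> to \<open>3\<close> are the exchange of \<open>a\<close> and \<open>b\<close>, the inversion of \<open>b\<close>, the substitution \<open>a \<mapsto> b a\<close> and the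
  conjugation by \<open>a\<close>. Every other number is the identity, so that shorter sequences can be padded
  to a given length.\<close>

definition move_img :: "nat \<Rightarrow> basis \<Rightarrow> basis word" where
  "move_img m c =
    (if m = 0 then (case c of A \<Rightarrow> [(B, True)] | B \<Rightarrow> [(A, True)])
     else if m = 1 then (case c of A \<Rightarrow> [(A, True)] | B \<Rightarrow> [(B, False)])
     else if m = 2 then (case c of A \<Rightarrow> [(B, True), (A, True)] | B \<Rightarrow> [(B, True)])
     else if m = 3 then (case c of A \<Rightarrow> [(A, True)] | B \<Rightarrow> [(A, True), (B, True), (A, False)])
     else [(c, True)])"

definition subst_letter :: "nat \<Rightarrow> basis letter \<Rightarrow> basis word" where
  "subst_letter m x = (if snd x then move_img m (fst x) else inv_word (move_img m (fst x)))"

text \<open>Moves act on words without intermediate reduction.\<close>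

definition subst :: "nat \<Rightarrow> basis word \<Rightarrow> basis word" where
  "subst m w = concat (map (subst_letter m) w)"

definition move :: "nat \<Rightarrow> basis fg \<Rightarrow> basis fg" where
  "move m = sub (of_word (move_img m A)) (of_word (move_img m B))"

definition moves :: "nat list \<Rightarrow> basis fg \<Rightarrow> basis fg" where
  "moves ms h = foldl (\<lambda>h m. move m h) h ms"

lemma additive_move [simp]: "additive (move m)"
  by (simp add: move_def)

lemma of_word_subst: "of_word (subst m w) = move m (of_word w)"
proof -
  have "of_word (subst_letter m x) = move m (letter x)" for x
    by (cases x; cases "fst x")
      (auto simp: subst_letter_def move_def letter_False of_word_inv_word)
  then show ?thesis
    by (induction w)
      (simp_all add: subst_def of_word_append of_word_Cons additiveD[OF additive_move])
qed

lemma of_word_foldl_subst: "of_word (foldl (\<lambda>w m. subst m w) w ms) = moves ms (of_word w)"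
  by (induction ms arbitrary: w) (simp_all add: moves_def of_word_subst)

lemma move_simps:
  "move 0 = swap" "move (Suc 0) = perm (A, True) (B, False)" "move 2 = Lm" "move 3 = conj_by ga"
  "3 < m \<Longrightarrow> move m = id"
  by (rule additive_ext_basis;
      simp add: move_def move_img_def Lm_def of_word_Cons letter_False conj_by_def group_simps)+

text \<open>Products of exactly \<open>k\<close> moves. The entries of the list are bounded by \<open>4\<close>, which includes one
  identity move, so that there are only finitely many lists for each \<open>k\<close>.\<close>

definition reach :: "nat \<Rightarrow> (basis fg \<Rightarrow> basis fg) \<Rightarrow> bool" where
  "reach k f \<longleftrightarrow> (\<exists>ms. length ms = k \<and> set ms \<subseteq> {..4} \<and> moves ms = f)"

lemma moves_append: "moves (ms @ ms') = moves ms' \<circ> moves ms"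
  by (simp add: moves_def fun_eq_iff)

lemma reach_comp: "reach k f \<Longrightarrow> reach l g \<Longrightarrow> reach (k + l) (g \<circ> f)"
  unfolding reach_def
proof (elim exE conjE)
  fix ms ms' assume "length ms = k" "set ms \<subseteq> {..4}" "moves ms = f"
    "length ms' = l" "set ms' \<subseteq> {..4}" "moves ms' = g"
  then show "\<exists>ms. length ms = k + l \<and> set ms \<subseteq> {..4} \<and> moves ms = g \<circ> f"
    by (intro exI[of _ "ms @ ms'"]) (simp add: moves_append)
qed

lemma reach_move: "m \<le> 4 \<Longrightarrow> reach 1 (move m)"
  unfolding reach_def by (intro exI[of _ "[m]"]) (simp add: moves_def fun_eq_iff)

lemma reach_id: "reach k id"
proof -
  have "moves (replicate k 4) = id"
    by (induction k) (simp_all add: moves_def fun_eq_iff move_simps)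
  then show ?thesis unfolding reach_def by (intro exI[of _ "replicate k 4"]) auto
qed

lemma reach_mono: "reach k f \<Longrightarrow> k \<le> l \<Longrightarrow> reach l f"
  using reach_comp[of k f "l - k" id] reach_id[of "l - k"] by simp

lemma reach_perm:
  assumes "fst x \<noteq> fst z"
  shows "reach 5 (perm x z)"
proof -
  define s where "s = perm (A, True) (B, False)"
  have swap: "reach 1 swap" and s: "reach 1 s"
    using reach_move[of 0] reach_move[of 1] by (simp_all add: move_simps s_def)
  have s': "reach 3 (swap \<circ> (s \<circ> swap))"
    using reach_comp[OF reach_comp[OF swap s] swap] by (simp add: eval_nat_numeral)
  have signs: "reach 4 (perm (A, p) (B, q))" for p q
  proof -
    have "perm (A, p) (B, q) = (if q then id else s) \<circ> (if p then id else swap \<circ> (s \<circ> swap))"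
      by (cases p; cases q; rule additive_ext_basis; simp add: s_def letter_False)
    moreover have "reach (3 + 1) ((if q then id else s) \<circ> (if p then id else swap \<circ> (s \<circ> swap)))"
      using s s' reach_id by (intro reach_comp) auto
    ultimately show ?thesis by simp
  qed
  show ?thesis
  proof (cases "fst x")
    case A
    then have "perm x z = perm (A, snd x) (B, snd z)"
      using assms by (cases x; cases z; cases "fst z") auto
    then show ?thesis using reach_mono[OF signs] by simp
  next
    case B
    then have "perm x z = perm (A, snd z) (B, snd x) \<circ> swap"
      using assms by (cases x; cases z; cases "fst z") (auto intro!: additive_ext_basis)
    then show ?thesis using reach_comp[OF swap signs] by simp
  qed
qed

lemma reach_conj_letter: "reach 11 (conj_by (letter y))"
proof -
  obtain z :: "basis letter" where z: "fst y \<noteq> fst z"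
    by (cases "fst y") (metis basis.distinct(1) fst_conv)+
  obtain u v where uv: "fst u \<noteq> fst v" "perm y z \<circ> perm u v = id"
    by (rule perm_inverse[OF z])
  have "reach (5 + 1 + 5) (perm y z \<circ> (conj_by ga \<circ> perm u v))"
    using reach_comp[OF reach_comp[OF reach_perm[OF uv(1)] reach_move[of 3]] reach_perm[OF z]]
    by (simp add: move_simps)
  also have "perm y z \<circ> (conj_by ga \<circ> perm u v) = conj_by (letter y)"
  proof
    fix h
    show "(perm y z \<circ> (conj_by ga \<circ> perm u v)) h = conj_by (letter y) h"
      using fun_cong[OF uv(2), of h] by (simp add: additive_conj_by_swap[OF additive_sub])
  qed
  finally show ?thesis by simp
qed

lemma reach_conj: "reach (11 * len g) (conj_by g)"
proof -
  have "reach (11 * length w) (conj_by (of_word w))" for w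
  proof (induction w)
    case (Cons x w)
    have "conj_by (letter x) \<circ> conj_by (of_word w) = conj_by (of_word (x # w))"
      by (simp add: fun_eq_iff of_word_Cons)
    with reach_comp[OF Cons reach_conj_letter[of x]] show ?case by (simp add: algebra_simps)
  next
    case Nil
    from reach_id[of 0] show ?case by (simp only: of_word_Nil conj_by_simps(1) list.size mult_0_right)
  qed
  from this[of "word_of g"] show ?thesis by (simp add: len_def)
qed

lemma reach_Linv: "reach 3 Linv"
proof -
  let ?s = "perm (A, True) (B, False)"
  have "reach (1 + 1 + 1) (?s \<circ> (Lm \<circ> ?s))"
    using reach_comp[OF reach_comp[OF reach_move[of 1] reach_move[of 2]] reach_move[of 1]]
    by (simp add: move_simps)
  also have "?s \<circ> (Lm \<circ> ?s) = Linv"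
    by (rule additive_ext_basis) (simp_all add: Lm_def Linv_def letter_False)
  finally show ?thesis by (simp add: eval_nat_numeral)
qed

lemma reach_tau_inverse: "\<exists>f. reach (5 * length ds) f \<and> additive f \<and> (\<forall>h. f (tau ds h) = h)"
proof (induction ds)
  case Nil
  have "tau [] = id" by (simp add: fun_eq_iff)
  with reach_id[of 0] show ?case by (metis additive_id(1) id_apply list.size(3) mult_0_right)
next
  case (Cons d ds)
  then obtain f where f: "reach (5 * length ds) f" "additive f" "\<And>h. f (tau ds h) = h" by blast
  let ?r = "if d then Linv else swap \<circ> (Linv \<circ> swap)"
  have "reach 1 swap" using reach_move[of 0] by (simp add: move_simps)
  from reach_comp[OF reach_comp[OF this reach_Linv] this]
  have "reach 5 (swap \<circ> (Linv \<circ> swap))" by simp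
  with reach_mono[OF reach_Linv, of 5] have r: "reach 5 ?r" "additive ?r" by auto
  have "swap (Linv (swap (Rm h))) = h" for h
  proof -
    have "swap \<circ> (Linv \<circ> (swap \<circ> Rm)) = id"
      by (rule additive_ext_basis) (simp_all add: Linv_def Rm_def group_simps)
    then show ?thesis by (auto simp: fun_eq_iff)
  qed
  then have inv: "\<forall>h. (f \<circ> ?r) (tau (d # ds) h) = h" by (simp add: f(3))
  have "5 * length (d # ds) = 5 + 5 * length ds" by simp
  with reach_comp[OF r(1) f(1)] have "reach (5 * length (d # ds)) (f \<circ> ?r)" by (simp only:)
  with inv additive_comp[OF f(2) r(2)] show ?case by blast
qed

lemma len_sub:
  assumes "len u \<le> M" "len v \<le> M"
  shows "len (sub u v h) \<le> M * len h"
proof -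
  have letter: "len (sub u v (letter x)) \<le> M" for x
    using assms by (cases x; cases "fst x"; cases "snd x") (auto simp: letter_False)
  have "len (sub u v (of_word w)) \<le> M * length w" for w
  proof (induction w)
    case (Cons x w)
    then show ?case
      using len_add[of "sub u v (letter x)" "sub u v (of_word w)"] letter[of x] by (simp add: of_word_Cons)
  qed simp
  from this[of "word_of h"] show ?thesis by (simp add: len_def)
qed

text \<open>Up to seven moves apply the signed permutation and, for \<open>K\<close> and its mirror image, \<open>a \<mapsto> b a\<close>, after which
  the subgroup is \<open>\<langle>p a b, p b a\<rangle>\<close>. This may double the lengths, so \<open>bounded_normal_form\<close> is applied
  with \<open>2 L\<close>. Then \<open>10 L + 5\<close> letters of the conjugator take eleven moves each, and \<open>8 L + 4\<close> factors of
  \<open>tau\<close> take five moves each to be undone.\<close>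

lemma moves_if_normal:
  assumes "normal H" and H: "\<forall>h\<in>H. len h \<le> L"
  shows "\<exists>ms. length ms = 150 * L + 82 \<and> set ms \<subseteq> {..4} \<and> (\<forall>h\<in>H. moves ms h \<in> sg (Zgen []))"
proof -
  from assms(1) obtain x z g X where xz: "fst x \<noteq> fst z" "base X"
    and *: "\<And>h. h \<in> H \<Longrightarrow> perm x z (conj_by g h) \<in> sg X"
    by (rule normalE) blast
  have LK: "Lm h \<in> sg (Zgen [])" if "h \<in> sg Kgen" for h
    using sg_image_subset[of Lm Kgen "Zgen []"] that
    by (auto simp: Zgen_def Lm_def conj_by_def group_simps intro: sg_base)
  have swapK: "swap h \<in> sg Kgen" if "h \<in> sg Kgen'" for h
    using sg_image_subset[of swap Kgen' "Kgen"] that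
    by (auto simp: conj_by_def intro: sg_base)
  have perm: "len (perm x z h) \<le> len h" for h
    using len_sub[of "letter x" 1 "letter z" h] by simp
  have Lm: "len (Lm h) \<le> 2 * len h" for h
    using len_add[of gb ga] unfolding Lm_def by (intro len_sub) auto
  have swap: "len (swap h) \<le> len h" for h
    using len_sub[of gb 1 ga h] by simp
  have rL: "reach 1 Lm" and rs: "reach 1 swap"
    using reach_move[of 2] reach_move[of 0] by (simp_all add: move_simps)
  have "\<exists>p ds. additive p \<and> reach 7 p \<and> (\<forall>h. len (p h) \<le> 2 * len h) \<and> (\<forall>h\<in>H. p (conj_by g h) \<in> sg (Zgen ds))"
    using xz(2)
  proof cases
    case 1
    show ?thesis
    proof (intro exI conjI)
      show "reach 7 (Lm \<circ> perm x z)"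
        using reach_mono[OF reach_comp[OF reach_perm[OF xz(1)] rL], of 7] by simp
      show "\<forall>h\<in>H. (Lm \<circ> perm x z) (conj_by g h) \<in> sg (Zgen [])"
        using * LK 1 by auto
      show "\<forall>h. len ((Lm \<circ> perm x z) h) \<le> 2 * len h"
        using Lm perm by (auto intro: order_trans[OF Lm])
    qed simp
  next
    case 2
    show ?thesis
    proof (intro exI conjI)
      show "reach 7 (Lm \<circ> (swap \<circ> perm x z))"
        using reach_comp[OF reach_comp[OF reach_perm[OF xz(1)] rs] rL] by simp
      show "\<forall>h\<in>H. (Lm \<circ> (swap \<circ> perm x z)) (conj_by g h) \<in> sg (Zgen [])"
        using * LK swapK 2 by auto
      show "\<forall>h. len ((Lm \<circ> (swap \<circ> perm x z)) h) \<le> 2 * len h"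
        using swap perm by (auto intro!: order_trans[OF Lm] intro: order_trans[OF swap perm])
    qed simp
  next
    case (3 ds)
    show ?thesis
    proof (intro exI conjI)
      show "reach 7 (perm x z)"
        using reach_mono[OF reach_perm[OF xz(1)], of 7] by simp
      show "\<forall>h\<in>H. perm x z (conj_by g h) \<in> sg (Zgen ds)" using * 3 by auto
      show "\<forall>h. len (perm x z h) \<le> 2 * len h"
        by (auto intro: order_trans[OF perm])
    qed simp
  qed
  then obtain p ds where p: "additive p" "reach 7 p" "\<And>h. len (p h) \<le> 2 * len h"
    and ds: "\<forall>h\<in>H. p (conj_by g h) \<in> sg (Zgen ds)" by blast
  have "len (p h) \<le> 2 * L" if "h \<in> H" for h
    using H that by (intro order_trans[OF p(3)]) simp
  then have "\<forall>h\<in>p ` H. len h \<le> 2 * L" by blast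
  moreover have "\<forall>h\<in>p ` H. conj_by (p g) h \<in> sg (Zgen ds)"
    using ds by (simp add: additive_conj_by_swap[OF p(1)])
  ultimately obtain g' ds' where b: "len g' \<le> 5 * (2 * L) + 5" "length ds' \<le> 4 * (2 * L) + 4"
    "\<forall>h\<in>p ` H. conj_by g' h \<in> sg (Zgen ds')"
    by (rule bounded_normal_form)
  obtain f where f: "reach (5 * length ds') f" "additive f" "\<And>h. f (tau ds' h) = h"
    using reach_tau_inverse by blast
  have "f ` sg (Zgen ds') \<subseteq> sg (Zgen [])"
    by (intro sg_image_subset f(2)) (auto simp: Zgen_def f(3) intro: sg_base)
  with b(3) have fin: "\<forall>h\<in>H. (f \<circ> (conj_by g' \<circ> p)) h \<in> sg (Zgen [])" by auto
  have "reach (7 + 11 * len g' + 5 * length ds') (f \<circ> (conj_by g' \<circ> p))"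
    by (intro reach_comp p f reach_conj)
  moreover have "7 + 11 * len g' + 5 * length ds' \<le> 150 * L + 82" using b by linarith
  ultimately have "reach (150 * L + 82) (f \<circ> (conj_by g' \<circ> p))" by (rule reach_mono)
  then obtain ms where "length ms = 150 * L + 82" "set ms \<subseteq> {..4}" "moves ms = f \<circ> (conj_by g' \<circ> p)"
    unfolding reach_def by blast
  with fin show ?thesis by (intro exI[of _ ms]) simp
qed

lemma bij_move: "bij (move m)"
proof -
  have id: "perm (A, True) (B, True) = id" by (rule additive_ext_basis) auto
  have inv: "perm x z \<circ> perm x z = id \<Longrightarrow> bij (perm x z)" for x z by (rule o_bij)
  consider "m = 0" | "m = 1" | "m = 2" | "m = 3" | "3 < m" by linarith
  then show ?thesis
  proof cases
    case 1
    have "swap \<circ> swap = id" by auto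
    with 1 show ?thesis by (simp add: move_simps inv)
  next
    case 2
    have "perm (A, True) (B, False) \<circ> perm (A, True) (B, False) = id"
      by (rule additive_ext_basis) (auto simp: letter_False)
    with 2 show ?thesis by (simp add: move_simps inv)
  next
    case 3
    have "bij Lm" by (rule o_bij[of Linv]) (auto simp: fun_eq_iff)
    with 3 show ?thesis by (simp add: move_simps)
  next
    case 4
    then show ?thesis by (simp add: move_simps bij_conj_by)
  qed (simp add: move_simps)
qed

lemma moves_Cons: "moves (m # ms) = moves ms \<circ> move m"
  by (simp add: moves_def fun_eq_iff)

lemma additive_moves: "additive (moves ms)"
proof (induction ms)
  case Nil
  show ?case by (simp add: moves_def)
next
  case (Cons m ms)
  then show ?case unfolding moves_Cons by (intro additive_comp) auto
qed

lemma bij_moves: "bij (moves ms)"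
proof (induction ms)
  case Nil
  have "moves [] = id" by (simp add: moves_def fun_eq_iff)
  with bij_id show ?case by (simp only:)
next
  case (Cons m ms)
  then show ?case unfolding moves_Cons by (intro bij_comp bij_move)
qed

section \<open>Transfer to the group of reduced words\<close>

lemma carrier_F2: "carrier F2 = range word_of"
proof -
  have "w \<in> range word_of" if "reduced w" for w :: "basis word"
    using that by (intro range_eqI[of _ _ "of_word w"]) (simp add: word_of_of_word reduce_reduced)
  then show ?thesis by (auto simp: free_group_def)
qed

lemma mult_F2: "word_of x \<otimes>\<^bsub>F2\<^esub> word_of y = word_of (x + y)"
  by (simp add: free_group_def plus_fg_def word_of_of_word)

lemma one_F2: "\<one>\<^bsub>F2\<^esub> = word_of 0"
  by (simp add: free_group_def)

lemma inv_F2: "inv\<^bsub>F2\<^esub> word_of x = word_of (- x)"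
proof -
  interpret group F2 by (rule group_free_group)
  show ?thesis
    by (rule inv_equality) (simp_all add: mult_F2 one_F2 carrier_F2)
qed

lemma generate_F2: "generate F2 (word_of ` S) = word_of ` sg S"
proof
  show "generate F2 (word_of ` S) \<subseteq> word_of ` sg S"
  proof
    fix w assume "w \<in> generate F2 (word_of ` S)"
    then show "w \<in> word_of ` sg S"
    proof (induction rule: generate.induct)
      case one
      show ?case unfolding one_F2 by (intro imageI sg_zero)
    next
      case (incl h)
      then show ?case by (auto intro: sg_base)
    next
      case (inv h)
      then obtain s where "h = word_of s" "- s \<in> sg S" using sg_uminus[OF sg_base] by blast
      then show ?case by (simp add: inv_F2)
    next
      case (eng h1 h2)
      then show ?case by (auto simp: mult_F2 intro: sg_add)
    qed
  qed
  have "word_of x \<in> generate F2 (word_of ` S)" if "x \<in> sg S" for x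
    using that
  proof (induction rule: sg.induct)
    case sg_zero
    show ?case unfolding one_F2[symmetric] by (rule generate.one)
  next
    case (sg_plus s h)
    then show ?case
      unfolding mult_F2[symmetric] by (intro generate.eng[OF generate.incl]) auto
  next
    case (sg_minus s h)
    then show ?case unfolding mult_F2[symmetric] inv_F2[symmetric]
      by (intro generate.eng[OF generate.inv]) auto
  qed
  then show "word_of ` sg S \<subseteq> generate F2 (word_of ` S)" by blast
qed

lemma subgroup_of_words_eq: "subgroup_of_words ws = word_of ` sg (of_word ` set ws)"
proof -
  have "reduce ` set ws = word_of ` of_word ` set ws"
    by (simp add: image_image word_of_of_word)
  then show ?thesis by (simp add: subgroup_of_words_def generate_F2)
qed

lemma target_eq: "generate F2 {gen A, conjugate F2 (gen A) (gen B)} = word_of ` sg Kgen"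
proof -
  have "gen A = word_of ga" "gen B = word_of gb" by (simp_all add: gen_def)
  then have "{gen A, conjugate F2 (gen A) (gen B)} = {word_of ga, word_of (conj_by (- gb) ga)}"
    by (simp only: conjugate_def inv_F2 mult_F2 conj_by_def diff_minus_eq_add)
  then have "{gen A, conjugate F2 (gen A) (gen B)} = word_of ` Kgen"
    unfolding image_insert image_empty .
  then show ?thesis by (simp only: generate_F2)
qed

lemma auto_F2_iff:
  "(\<exists>\<phi>\<in>auto F2. \<phi> ` word_of ` S \<subseteq> word_of ` T) \<longleftrightarrow> (\<exists>f. additive f \<and> bij f \<and> f ` S \<subseteq> T)"
proof
  assume "\<exists>\<phi>\<in>auto F2. \<phi> ` word_of ` S \<subseteq> word_of ` T"
  then obtain \<phi> where phi: "\<phi> \<in> hom F2 F2" "bij_betw \<phi> (carrier F2) (carrier F2)"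
    and ST: "\<phi> ` word_of ` S \<subseteq> word_of ` T" by (auto simp: auto_def Bij_def)
  define f where "f x = of_word (\<phi> (word_of x))" for x
  have f: "word_of (f x) = \<phi> (word_of x)" for x
  proof -
    have "\<phi> (word_of x) \<in> carrier F2" using bij_betwE[OF phi(2)] by (auto simp: carrier_F2)
    then show ?thesis by (auto simp: f_def carrier_F2)
  qed
  have "additive f"
    unfolding additive_def
  proof (intro allI)
    fix x y
    have "\<phi> (word_of (x + y)) = \<phi> (word_of x) \<otimes>\<^bsub>F2\<^esub> \<phi> (word_of y)"
      unfolding mult_F2[symmetric] by (rule hom_mult[OF phi(1)]) (auto simp: carrier_F2)
    then have "word_of (f (x + y)) = word_of (f x + f y)" by (simp only: f[symmetric] mult_F2)
    then show "f (x + y) = f x + f y" by (simp only: word_of_inject)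
  qed
  moreover have "bij f"
  proof (rule bijI)
    show "inj f"
    proof (rule injI)
      fix x y assume "f x = f y"
      then have "\<phi> (word_of x) = \<phi> (word_of y)" by (simp only: f[symmetric])
      with bij_betw_imp_inj_on[OF phi(2)] have "word_of x = word_of y"
        by (rule inj_onD) (auto simp: carrier_F2)
      then show "x = y" by (simp only: word_of_inject)
    qed
    have "y \<in> range f" for y
    proof -
      have "word_of y \<in> \<phi> ` carrier F2"
        using bij_betw_imp_surj_on[OF phi(2)] by (auto simp: carrier_F2)
      then obtain x where "word_of y = word_of (f x)" by (auto simp: carrier_F2 f)
      then show ?thesis by (simp add: word_of_inject)
    qed
    then show "surj f" by auto
  qed
  moreover have "f ` S \<subseteq> T"
  proof
    fix y assume "y \<in> f ` S"
    then obtain x where "x \<in> S" "y = f x" by blast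
    with ST have "word_of y \<in> word_of ` T" by (auto simp: f)
    then show "y \<in> T" by (auto simp: word_of_inject)
  qed
  ultimately show "\<exists>f. additive f \<and> bij f \<and> f ` S \<subseteq> T" by blast
next
  assume "\<exists>f. additive f \<and> bij f \<and> f ` S \<subseteq> T"
  then obtain f where f: "additive f" "bij f" "f ` S \<subseteq> T" by blast
  define \<phi> where "\<phi> = restrict (\<lambda>w. word_of (f (of_word w))) (carrier F2)"
  have phi: "\<phi> (word_of x) = word_of (f x)" for x by (simp add: \<phi>_def carrier_F2)
  have "\<phi> \<in> hom F2 F2"
    by (auto simp: hom_def carrier_F2 phi mult_F2 additiveD[OF f(1)])
  moreover have "bij_betw \<phi> (carrier F2) (carrier F2)"
    unfolding bij_betw_def
  proof
    show "inj_on \<phi> (carrier F2)"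
      using bij_is_inj[OF f(2)] by (auto simp: inj_on_def carrier_F2 phi word_of_inject dest: injD)
    have "\<phi> ` carrier F2 = word_of ` range f" by (auto simp: carrier_F2 phi image_iff)
    then show "\<phi> ` carrier F2 = carrier F2"
      using bij_is_surj[OF f(2)] by (simp add: carrier_F2)
  qed
  moreover have "\<phi> \<in> extensional (carrier F2)" by (simp add: \<phi>_def)
  moreover have "\<phi> ` word_of ` S \<subseteq> word_of ` T" using f(3) by (auto simp: phi)
  ultimately show "\<exists>\<phi>\<in>auto F2. \<phi> ` word_of ` S \<subseteq> word_of ` T"
    by (auto simp: auto_def Bij_def)
qed

abbreviation (input) embeddable :: "basis word list \<Rightarrow> bool" where
  "embeddable ws \<equiv> \<exists>\<phi>\<in>auto F2. \<phi> ` subgroup_of_words ws \<subseteq> generate F2 {gen A, conjugate F2 (gen A) (gen B)}"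

lemma embeddable_iff: "embeddable ws \<longleftrightarrow> (\<exists>f. additive f \<and> bij f \<and> f ` sg (of_word ` set ws) \<subseteq> sg Kgen)"
  unfolding subgroup_of_words_eq target_eq by (rule auto_F2_iff)

lemma embeddable_if_moves:
  assumes "\<forall>w\<in>set ws. moves ms (of_word w) \<in> sg (Zgen [])"
  shows "embeddable ws"
proof -
  have "Linv ` sg (Zgen []) \<subseteq> sg Kgen"
    by (intro sg_image_subset) (auto simp: Zgen_def Linv_def conj_by_def group_simps intro: sg_base)
  with assms have "(Linv \<circ> moves ms) ` of_word ` set ws \<subseteq> sg Kgen" by auto
  moreover have add: "additive (Linv \<circ> moves ms)"
    by (intro additive_comp additive_moves) simp
  ultimately have "(Linv \<circ> moves ms) ` sg (of_word ` set ws) \<subseteq> sg Kgen"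
    by (intro sg_image_subset)
  moreover have "bij Linv" by (rule o_bij[of Lm]) (auto simp: fun_eq_iff)
  then have "bij (Linv \<circ> moves ms)" by (intro bij_comp bij_moves)
  ultimately show ?thesis unfolding embeddable_iff using add by blast
qed

lemma moves_if_embeddable:
  assumes "embeddable ws" and L: "\<And>w. w \<in> set ws \<Longrightarrow> length w \<le> L"
  obtains ms where "length ms = 150 * L + 82" "set ms \<subseteq> {..4}"
    "\<forall>w\<in>set ws. moves ms (of_word w) \<in> sg (Zgen [])"
proof -
  from assms(1) obtain f where f: "additive f" "bij f" "f ` sg (of_word ` set ws) \<subseteq> sg Kgen"
    unfolding embeddable_iff by blast
  have "f ` of_word ` set ws \<subseteq> sg Kgen" using f(3) by (auto intro: sg_base)
  with f have "normal (of_word ` set ws)" by (intro normal_if_embeds)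
  moreover have "\<forall>h\<in>of_word ` set ws. len h \<le> L"
    using L by (auto intro: order_trans[OF len_of_word])
  ultimately show ?thesis using that moves_if_normal by fastforce
qed

section \<open>Recursive functions of several arguments\<close>

text \<open>Only the values at lists of length \<open>n\<close> matter. Unlike \<^const>\<open>recursive\<close> itself, this notion does
  not distinguish functions that differ at lists of other lengths.\<close>

definition computes :: "nat \<Rightarrow> (nat list \<Rightarrow> nat) \<Rightarrow> bool" where
  "computes n f \<longleftrightarrow> (\<exists>g. recursive n g \<and> (\<forall>xs. length xs = n \<longrightarrow> g xs = f xs))"

lemma computes_cong:
  "computes n f \<Longrightarrow> (\<And>xs. length xs = n \<Longrightarrow> f xs = g xs) \<Longrightarrow> computes n g"
  by (auto simp: computes_def)

lemma computes_comp:
  assumes g: "computes (length fs) g" and fs: "\<And>f. f \<in> set fs \<Longrightarrow> computes n f"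
  shows "computes n (\<lambda>xs. g (map (\<lambda>f. f xs) fs))"
proof -
  obtain g' where g': "recursive (length fs) g'" "\<And>xs. length xs = length fs \<Longrightarrow> g' xs = g xs"
    using g by (auto simp: computes_def)
  have "\<forall>f\<in>set fs. \<exists>h. recursive n h \<and> (\<forall>xs. length xs = n \<longrightarrow> h xs = f xs)"
    using fs by (auto simp: computes_def)
  then obtain H where H: "\<And>f. f \<in> set fs \<Longrightarrow> recursive n (H f)"
    "\<And>f xs. f \<in> set fs \<Longrightarrow> length xs = n \<Longrightarrow> H f xs = f xs"
    by metis
  have "recursive n (\<lambda>xs. g' (map (\<lambda>f. f xs) (map H fs)))"
    using g' H by (intro recursive.comp) auto
  moreover have "g' (map (\<lambda>f. f xs) (map H fs)) = g (map (\<lambda>f. f xs) fs)" if "length xs = n" for xs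
  proof -
    have "map (\<lambda>f. f xs) (map H fs) = map (\<lambda>f. f xs) fs"
      using H(2) that by simp
    then show ?thesis using g'(2)[of "map (\<lambda>f. f xs) fs"] by (simp del: map_map)
  qed
  ultimately show ?thesis unfolding computes_def by blast
qed

lemma computes_zero: "computes n (\<lambda>xs. 0)"
  unfolding computes_def using recursive.zero by blast

lemma computes_proj: "i < n \<Longrightarrow> computes n (\<lambda>xs. xs ! i)"
  unfolding computes_def using recursive.proj by blast

lemma computes_comp1:
  assumes "computes 1 (\<lambda>xs. g (xs ! 0))" "computes n f"
  shows "computes n (\<lambda>xs. g (f xs))"
  using computes_comp[of "[f]" "\<lambda>xs. g (xs ! 0)"] assms by simp

lemma computes_comp2:
  assumes "computes 2 (\<lambda>xs. g (xs ! 0) (xs ! 1))" "computes n f1" "computes n f2"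
  shows "computes n (\<lambda>xs. g (f1 xs) (f2 xs))"
  using computes_comp[of "[f1, f2]" "\<lambda>xs. g (xs ! 0) (xs ! 1)" n] assms
  by (auto simp: eval_nat_numeral)

lemma computes_Suc: "computes n f \<Longrightarrow> computes n (\<lambda>xs. Suc (f xs))"
proof (rule computes_comp1[where g = Suc])
  have "hd xs = xs ! 0" if "length xs = 1" for xs :: "nat list"
    using that by (intro hd_conv_nth) auto
  then show "computes 1 (\<lambda>xs. Suc (xs ! 0))"
    unfolding computes_def using recursive.succ by fastforce
qed

lemma computes_rec:
  assumes f: "computes 1 (\<lambda>xs. f (xs ! 0))"
    and g: "computes 3 (\<lambda>xs. g (xs ! 0) (xs ! 1) (xs ! 2))"
  shows "computes 2 (\<lambda>xs. rec_nat (f (xs ! 1)) (\<lambda>k r. g k r (xs ! 1)) (xs ! 0))"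
proof -
  obtain f' where f': "recursive 1 f'" "\<And>xs. length xs = 1 \<Longrightarrow> f' xs = f (xs ! 0)"
    using f by (auto simp: computes_def)
  obtain g' where g': "recursive 3 g'" "\<And>xs. length xs = 3 \<Longrightarrow> g' xs = g (xs ! 0) (xs ! 1) (xs ! 2)"
    using g by (auto simp: computes_def)
  have "recursive 2 (\<lambda>xs. rec_nat (f' (tl xs)) (\<lambda>k r. g' (k # r # tl xs)) (hd xs))"
    using recursive.prim_rec[of 1 f' g'] f'(1) g'(1) by (simp add: eval_nat_numeral)
  moreover have "rec_nat (f' (tl xs)) (\<lambda>k r. g' (k # r # tl xs)) (hd xs) =
      rec_nat (f (xs ! 1)) (\<lambda>k r. g k r (xs ! 1)) (xs ! 0)" if "length xs = 2" for xs
  proof -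
    from that obtain x y where xs: "xs = [x, y]"
      by (auto simp: eval_nat_numeral length_Suc_conv)
    show ?thesis by (simp add: xs f'(2) g'(2))
  qed
  ultimately show ?thesis unfolding computes_def by blast
qed

lemma computes_least:
  assumes f: "computes 2 (\<lambda>xs. f (xs ! 0) (xs ! 1))" and ex: "\<And>x. \<exists>k. f k x = 0"
  shows "computes 1 (\<lambda>xs. LEAST k. f k (xs ! 0) = 0)"
proof -
  obtain f' where f': "recursive 2 f'" "\<And>xs. length xs = 2 \<Longrightarrow> f' xs = f (xs ! 0) (xs ! 1)"
    using f by (auto simp: computes_def)
  have eq: "f' (k # xs) = f k (xs ! 0)" if "length xs = 1" for xs k
    using that f'(2)[of "k # xs"] by simp
  have "recursive 1 (\<lambda>xs. LEAST k. f' (k # xs) = 0)"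
    using f'(1) ex by (intro recursive.minim) (auto simp: eval_nat_numeral eq)
  moreover have "(LEAST k. f' (k # xs) = 0) = (LEAST k. f k (xs ! 0) = 0)" if "length xs = 1" for xs
    using that by (simp add: eq)
  ultimately show ?thesis unfolding computes_def by blast
qed

lemma computes_pred: "computes n f \<Longrightarrow> computes n (\<lambda>xs. f xs - 1)"
proof (rule computes_comp1[where g = "\<lambda>x. x - 1"])
  have "computes 2 (\<lambda>xs. rec_nat 0 (\<lambda>k r. k) (xs ! 0))"
    by (rule computes_rec[where f = "\<lambda>_. 0" and g = "\<lambda>k r x. k"])
      (intro computes_zero computes_proj; simp)+
  then have "computes 1 (\<lambda>xs. rec_nat 0 (\<lambda>k r. k) (xs ! 0))"
    by (rule computes_comp2[where g = "\<lambda>x y. rec_nat 0 (\<lambda>k r. k) x" and ?f2.0 = "\<lambda>xs. 0"])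
      (intro computes_proj computes_zero; simp)+
  then show "computes 1 (\<lambda>xs. xs ! 0 - 1)"
    by (rule computes_cong) (case_tac "xs ! 0"; simp)
qed

lemma computes_add: "computes n f \<Longrightarrow> computes n g \<Longrightarrow> computes n (\<lambda>xs. f xs + g xs)"
proof (rule computes_comp2[where g = "(+)"])
  have "computes 2 (\<lambda>xs. rec_nat (xs ! 1) (\<lambda>k r. Suc r) (xs ! 0))"
    by (rule computes_rec[where f = "\<lambda>x. x" and g = "\<lambda>k r x. Suc r"])
      (intro computes_Suc computes_proj; simp)+
  moreover have "rec_nat y (\<lambda>k r. Suc r) x = x + y" for x y :: nat by (induction x) auto
  ultimately show "computes 2 (\<lambda>xs. xs ! 0 + xs ! 1)" by simp
qed

lemma computes_diff: "computes n f \<Longrightarrow> computes n g \<Longrightarrow> computes n (\<lambda>xs. f xs - g xs)"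
proof (rule computes_comp2[where g = "\<lambda>x y. x - y"])
  have "computes 2 (\<lambda>xs. rec_nat (xs ! 1) (\<lambda>k r. r - 1) (xs ! 0))"
    by (rule computes_rec[where f = "\<lambda>x. x" and g = "\<lambda>k r x. r - 1"])
      (intro computes_pred computes_proj; simp)+
  moreover have "rec_nat y (\<lambda>k r. r - 1) x = y - x" for x y :: nat by (induction x) auto
  ultimately have "computes 2 (\<lambda>xs. xs ! 1 - xs ! 0)" by simp
  then show "computes 2 (\<lambda>xs. xs ! 0 - xs ! 1)"
    by (rule computes_comp2[where g = "\<lambda>x y. y - x"]) (auto intro: computes_proj)
qed

lemma computes_triangle: "computes n f \<Longrightarrow> computes n (\<lambda>xs. triangle (f xs))"
proof (rule computes_comp1[where g = triangle])
  have "computes 2 (\<lambda>xs. rec_nat 0 (\<lambda>k r. r + Suc k) (xs ! 0))"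
    by (rule computes_rec[where f = "\<lambda>_. 0" and g = "\<lambda>k r x. r + Suc k"])
      (intro computes_zero computes_proj computes_add computes_Suc; simp)+
  then have "computes 1 (\<lambda>xs. rec_nat 0 (\<lambda>k r. r + Suc k) (xs ! 0))"
    by (rule computes_comp2[where g = "\<lambda>x y. rec_nat 0 (\<lambda>k r. r + Suc k) x" and ?f2.0 = "\<lambda>xs. 0"])
      (intro computes_proj computes_zero; simp)+
  moreover have "rec_nat 0 (\<lambda>k r. r + Suc k) m = triangle m" for m by (induction m) auto
  ultimately show "computes 1 (\<lambda>xs. triangle (xs ! 0))" by simp
qed

lemma computes_prod_encode:
  "computes n f \<Longrightarrow> computes n g \<Longrightarrow> computes n (\<lambda>xs. prod_encode (f xs, g xs))"
  unfolding prod_encode_def by (simp add: computes_add computes_triangle)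

lemma triangle_mono: "m \<le> n \<Longrightarrow> triangle m \<le> triangle n"
  by (induction rule: dec_induct) auto

text \<open>The sum \<open>s\<close> of the two components of \<open>p\<close> is the least \<open>s\<close> such that \<open>p\<close> is smaller than the next triangular
  number, and is found by minimisation.\<close>

lemma computes_prod_decode:
  assumes "computes n f"
  shows "computes n (\<lambda>xs. fst (prod_decode (f xs)))" "computes n (\<lambda>xs. snd (prod_decode (f xs)))"
proof -
  let ?s = "\<lambda>p. LEAST k. Suc p - triangle (Suc k) = 0"
  have "p < triangle (Suc p)" for p by (induction p) auto
  then have s: "computes 1 (\<lambda>xs. ?s (xs ! 0))"
    by (intro computes_least computes_diff computes_triangle computes_Suc computes_proj)
       (auto simp: Suc_le_eq simp del: triangle_Suc)
  have sum: "?s p = fst (prod_decode p) + snd (prod_decode p)" for p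
  proof -
    obtain i j where ij: "prod_decode p = (i, j)" by fastforce
    then have p: "p = triangle (i + j) + i"
      using prod_decode_inverse[of p] by (simp add: prod_encode_def)
    have "?s p = i + j"
    proof (rule Least_equality)
      show "Suc p - triangle (Suc (i + j)) = 0" by (simp add: p)
      fix k assume k: "Suc p - triangle (Suc k) = 0"
      show "i + j \<le> k"
      proof (rule ccontr)
        assume "\<not> i + j \<le> k"
        then have "triangle (Suc k) \<le> triangle (i + j)" by (intro triangle_mono) simp
        with k show False by (simp add: p)
      qed
    qed
    with ij show ?thesis by simp
  qed
  have fst: "p - triangle (?s p) = fst (prod_decode p)" for p
  proof -
    have "p = triangle (fst (prod_decode p) + snd (prod_decode p)) + fst (prod_decode p)"
      using prod_decode_inverse[of p] by (simp add: prod_encode_def case_prod_unfold)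
    then show ?thesis unfolding sum by simp
  qed
  have snd: "?s p - fst (prod_decode p) = snd (prod_decode p)" for p
    unfolding sum by simp
  have "computes 1 (\<lambda>xs. xs ! 0 - triangle (?s (xs ! 0)))"
    by (intro computes_diff computes_proj computes_triangle s) simp
  then have F: "computes 1 (\<lambda>xs. fst (prod_decode (xs ! 0)))"
    unfolding fst .
  have "computes 1 (\<lambda>xs. ?s (xs ! 0) - fst (prod_decode (xs ! 0)))"
    by (intro computes_diff s F)
  then have S: "computes 1 (\<lambda>xs. snd (prod_decode (xs ! 0)))"
    unfolding snd .
  show "computes n (\<lambda>xs. fst (prod_decode (f xs)))" "computes n (\<lambda>xs. snd (prod_decode (f xs)))"
    using computes_comp1[OF F assms] computes_comp1[OF S assms] .
qed

section \<open>Computable functions between encoded types\<close>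

class encodable =
  fixes enc :: "'a \<Rightarrow> nat"
  assumes inj_enc: "inj enc"

lemma enc_eq_iff [simp]: "enc x = enc y \<longleftrightarrow> x = y"
  using inj_enc by (auto dest: injD)

instantiation nat :: encodable begin
definition "enc_nat (n::nat) = n"
instance by standard (simp add: enc_nat_def inj_on_def)
end

instantiation bool :: encodable begin
definition "enc_bool b = (if b then 1 else 0::nat)"
instance by standard (simp add: enc_bool_def inj_on_def)
end

instantiation basis :: encodable begin
definition "enc_basis x = (case x of A \<Rightarrow> 0::nat | B \<Rightarrow> 1)"
instance by standard (auto simp add: enc_basis_def inj_on_def split: basis.splits)
end

instantiation prod :: (encodable, encodable) encodable begin
definition "enc_prod p = prod_encode (enc (fst p), enc (snd p))"
instance by standard (auto simp: enc_prod_def inj_on_def)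
end

instantiation list :: (encodable) encodable begin
definition "enc_list xs = list_encode (map enc xs)"
instance
proof
  have "inj (map enc :: 'a list \<Rightarrow> nat list)" using inj_enc by (rule inj_mapI)
  then show "inj (enc :: 'a list \<Rightarrow> nat)"
    by (auto simp: enc_list_def inj_on_def list_encode_eq)
qed
end

lemma enc_Nil [simp]: "enc [] = 0"
  by (simp add: enc_list_def)

lemma enc_Cons [simp]: "enc (x # xs) = Suc (prod_encode (enc x, enc xs))"
  by (simp add: enc_list_def)

lemma list_encode_eq_enc: "list_encode xs = enc xs"
  by (simp add: enc_list_def enc_nat_def[abs_def])

text \<open>The code of \<open>f x\<close> is obtained from the code of \<open>x\<close> by a unary recursive function. Functions of several
  arguments and local parameters are treated by pairing.\<close>

definition computable :: "('a::encodable \<Rightarrow> 'b::encodable) \<Rightarrow> bool" where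
  "computable f \<longleftrightarrow> (\<exists>h. computes 1 (\<lambda>xs. h (xs ! 0)) \<and> (\<forall>x. h (enc x) = enc (f x)))"

lemma computableI:
  "computes 1 (\<lambda>xs. h (xs ! 0)) \<Longrightarrow> (\<And>x. h (enc x) = enc (f x)) \<Longrightarrow> computable f"
  unfolding computable_def by blast

named_theorems computable_intros

lemma computable_id [computable_intros]: "computable (\<lambda>x. x)"
  by (rule computableI[where h = "\<lambda>n. n"]) (intro computes_proj, simp, rule refl)

lemma computable_comp:
  assumes "computable f" "computable g"
  shows "computable (\<lambda>x. f (g x))"
proof -
  obtain h k where hk: "computes 1 (\<lambda>xs. h (xs ! 0))" "\<And>x. h (enc x) = enc (f x)"
    "computes 1 (\<lambda>xs. k (xs ! 0))" "\<And>x. k (enc x) = enc (g x)"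
    using assms unfolding computable_def by blast
  show ?thesis
    by (rule computableI[where h = "\<lambda>n. h (k n)"])
       (intro computes_comp1[OF hk(1)] hk(3), simp add: hk)
qed

lemma computable_Pair [computable_intros]:
  assumes "computable f" "computable g"
  shows "computable (\<lambda>x. (f x, g x))"
proof -
  obtain h k where hk: "computes 1 (\<lambda>xs. h (xs ! 0))" "\<And>x. h (enc x) = enc (f x)"
    "computes 1 (\<lambda>xs. k (xs ! 0))" "\<And>x. k (enc x) = enc (g x)"
    using assms unfolding computable_def by blast
  show ?thesis
    by (rule computableI[where h = "\<lambda>n. prod_encode (h n, k n)"])
      (intro computes_prod_encode hk, simp add: hk enc_prod_def)
qed

lemma computable_fst [computable_intros]: "computable (\<lambda>x. fst (f x))"
  and computable_snd [computable_intros]: "computable (\<lambda>x. snd (f x))"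
  if "computable f"
proof -
  have p: "computes 1 (\<lambda>xs. fst (prod_decode (xs ! 0)))" "computes 1 (\<lambda>xs. snd (prod_decode (xs ! 0)))"
    by (intro computes_prod_decode computes_proj; simp)+
  have "computable (fst :: 'b \<times> 'c \<Rightarrow> 'b)" "computable (snd :: 'b \<times> 'c \<Rightarrow> 'c)"
    by (rule computableI, rule p, simp add: enc_prod_def)+
  from computable_comp[OF this(1) that] computable_comp[OF this(2) that]
  show "computable (\<lambda>x. fst (f x))" "computable (\<lambda>x. snd (f x))" .
qed

lemma computes_const: "computes n (\<lambda>xs. c)"
proof (induction c)
  case 0
  show ?case by (rule computes_zero)
next
  case (Suc c)
  then show ?case by (rule computes_Suc)
qed

lemma computable_const [computable_intros]: "computable (\<lambda>x. c)"
  by (rule computableI[where h = "\<lambda>_. enc c"]) (rule computes_const, rule refl)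

lemma computable_enc [computable_intros]: "computable f \<Longrightarrow> computable (\<lambda>x. enc (f x))"
  unfolding computable_def enc_nat_def .

lemma computable_from_enc: "computable (\<lambda>x. enc (f x)) \<Longrightarrow> computable f"
  unfolding computable_def enc_nat_def .

lemma computable_Suc [computable_intros]: "computable f \<Longrightarrow> computable (\<lambda>x. Suc (f x))"
proof -
  assume "computable f"
  then obtain h where h: "computes 1 (\<lambda>xs. h (xs ! 0))" "\<And>x. h (enc x) = enc (f x)"
    unfolding computable_def by blast
  from h(1) have "computes 1 (\<lambda>xs. Suc (h (xs ! 0)))" by (rule computes_Suc)
  then show ?thesis by (rule computableI) (simp add: h(2) enc_nat_def)
qed

lemma computable_nat2:
  fixes f g :: "'a::encodable \<Rightarrow> nat"
  assumes op: "computes 1 (\<lambda>xs. op (fst (prod_decode (xs ! 0))) (snd (prod_decode (xs ! 0))))"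
    and "computable f" "computable g"
  shows "computable (\<lambda>x. op (f x) (g x))"
proof -
  have "computable (\<lambda>p. op (fst p) (snd p))"
    by (rule computableI[OF op]) (simp add: enc_prod_def enc_nat_def)
  from computable_comp[OF this computable_Pair[OF assms(2,3)]] show ?thesis by simp
qed

lemma computable_plus [computable_intros]: "computable f \<Longrightarrow> computable g \<Longrightarrow> computable (\<lambda>x. f x + g x :: nat)"
  by (rule computable_nat2[where op = "(+)"]) (intro computes_add computes_prod_decode computes_proj, simp+)

lemma computable_minus [computable_intros]: "computable f \<Longrightarrow> computable g \<Longrightarrow> computable (\<lambda>x. f x - g x :: nat)"
  by (rule computable_nat2[where op = "(-)"]) (intro computes_diff computes_prod_decode computes_proj, simp+)

lemma computable_rec:
  fixes n :: "'a::encodable \<Rightarrow> nat" and i :: "'a \<Rightarrow> 'b::encodable"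
  assumes n: "computable n" and i: "computable i"
    and s: "computable (\<lambda>p. s (fst p) (fst (snd p)) (snd (snd p)))"
  shows "computable (\<lambda>x. rec_nat (i x) (\<lambda>k r. s k r x) (n x))"
proof -
  obtain hn where hn: "computes 1 (\<lambda>xs. hn (xs ! 0))" "\<And>x. hn (enc x) = n x"
    using n unfolding computable_def enc_nat_def by blast
  obtain hi where hi: "computes 1 (\<lambda>xs. hi (xs ! 0))" "\<And>x. hi (enc x) = enc (i x)"
    using i unfolding computable_def by blast
  obtain hs where hs: "computes 1 (\<lambda>xs. hs (xs ! 0))"
    "\<And>p. hs (enc p) = enc (s (fst p) (fst (snd p)) (snd (snd p)))"
    using s unfolding computable_def by blast
  let ?g = "\<lambda>k r x. hs (prod_encode (k, prod_encode (r, x)))"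
  have "computes 3 (\<lambda>xs. ?g (xs ! 0) (xs ! 1) (xs ! 2))"
    by (intro computes_comp1[OF hs(1)] computes_prod_encode computes_proj; simp)
  from computes_rec[OF hi(1) this]
  have "computes 1 (\<lambda>xs. rec_nat (hi (xs ! 0)) (\<lambda>k r. ?g k r (xs ! 0)) (hn (xs ! 0)))"
    by (rule computes_comp2[where g = "\<lambda>m x. rec_nat (hi x) (\<lambda>k r. ?g k r x) m"])
      (intro hn(1) computes_proj; simp)+
  then show ?thesis
  proof (rule computableI)
    fix x
    have step: "?g k (enc r) (enc x) = enc (s k r x)" for k r
      using hs(2)[of "(k, r, x)"] by (simp add: enc_prod_def enc_nat_def)
    have "rec_nat (hi (enc x)) (\<lambda>k r. ?g k r (enc x)) m = enc (rec_nat (i x) (\<lambda>k r. s k r x) m)" for m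
      by (induction m) (simp_all add: hi(2) step)
    then show "rec_nat (hi (enc x)) (\<lambda>k r. ?g k r (enc x)) (hn (enc x))
        = enc (rec_nat (i x) (\<lambda>k r. s k r x) (n x))"
      by (simp add: hn(2))
  qed
qed

lemma computable_if [computable_intros]:
  fixes f g :: "'a::encodable \<Rightarrow> 'b::encodable"
  assumes "computable b" "computable f" "computable g"
  shows "computable (\<lambda>x. if b x then f x else g x)"
proof -
  have "computable (\<lambda>x. rec_nat (g x) (\<lambda>k r. f x) (enc (b x)))"
    by (rule computable_rec[where s = "\<lambda>k r x. f x"])
      (intro computable_enc assms computable_comp[OF assms(2)] computable_snd computable_id)+
  then show ?thesis
    by (rule back_subst[of computable]) (auto simp: enc_bool_def)
qed

lemma computable_not [computable_intros]: "computable b \<Longrightarrow> computable (\<lambda>x. \<not> b x)"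
proof -
  assume "computable b"
  then have "computable (\<lambda>x. if b x then False else True)" by (intro computable_intros)
  then show ?thesis by (rule back_subst[of computable]) auto
qed

lemma computable_and [computable_intros]: "computable b \<Longrightarrow> computable c \<Longrightarrow> computable (\<lambda>x. b x \<and> c x)"
proof -
  assume "computable b" "computable c"
  then have "computable (\<lambda>x. if b x then c x else False)" by (intro computable_intros)
  then show ?thesis by (rule back_subst[of computable]) auto
qed

lemma computable_or [computable_intros]: "computable b \<Longrightarrow> computable c \<Longrightarrow> computable (\<lambda>x. b x \<or> c x)"
proof -
  assume "computable b" "computable c"
  then have "computable (\<lambda>x. if b x then True else c x)" by (intro computable_intros)
  then show ?thesis by (rule back_subst[of computable]) auto
qed

lemma computable_is_0: "computable f \<Longrightarrow> computable (\<lambda>x. f x = (0::nat))"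
proof (rule computable_comp[where f = "\<lambda>n. n = 0"])
  have "computable (\<lambda>n. rec_nat True (\<lambda>k r. False) n)"
    by (rule computable_rec[where s = "\<lambda>k r x. False"]) (intro computable_id computable_const)+
  then show "computable (\<lambda>n. n = (0::nat))"
    by (rule back_subst[of computable]) (rule ext, case_tac n; simp)
qed

lemma computable_eq [computable_intros]:
  assumes "computable f" "computable g"
  shows "computable (\<lambda>x. f x = g x)"
proof -
  have "computable (\<lambda>x. (enc (f x) - enc (g x)) + (enc (g x) - enc (f x)) = 0)"
    using assms by (intro computable_is_0 computable_plus computable_minus computable_enc)
  also have "(\<lambda>x. (enc (f x) - enc (g x)) + (enc (g x) - enc (f x)) = 0) = (\<lambda>x. f x = g x)"
    by (auto simp: fun_eq_iff)
  finally show ?thesis .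
qed

text \<open>A function on a finite type is a finite table.\<close>

lemma computable_finite:
  fixes f :: "'a::{encodable, finite} \<Rightarrow> 'b::encodable"
  shows "computable f"
proof -
  have "\<exists>g. computable g \<and> (\<forall>x\<in>S. g x = f x)" if "finite S" for S
    using that
  proof (induction S)
    case empty
    have "computable (\<lambda>x::'a. undefined::'b)" by (rule computable_const)
    then show ?case by blast
  next
    case (insert y S)
    then obtain g where g: "computable g" "\<forall>x\<in>S. g x = f x" by blast
    have "computable (\<lambda>x. if x = y then f y else g x)"
      using g(1) by (intro computable_intros)
    with g(2) show ?case by (intro exI[of _ "\<lambda>x. if x = y then f y else g x"]) auto
  qed
  from this[of UNIV] obtain g where "computable g" "\<forall>x. g x = f x" by auto
  then show ?thesis by (metis ext)
qed

instance basis :: finite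
proof
  have "(UNIV :: basis set) = {A, B}" using basis.exhaust by auto
  then show "finite (UNIV :: basis set)" by (metis finite.emptyI finite.insertI)
qed

lemma computable_Cons [computable_intros]:
  assumes "computable f" "computable g"
  shows "computable (\<lambda>x. f x # g x)"
proof (rule computable_from_enc)
  have "computable (\<lambda>x. Suc (enc (f x, g x)))"
    by (intro computable_Suc computable_enc computable_Pair assms)
  then show "computable (\<lambda>x. enc (f x # g x))" by (simp add: enc_prod_def)
qed

lemma computes_hd_tl: "computes 1 (\<lambda>xs. fst (prod_decode (xs ! 0 - 1)))"
   "computes 1 (\<lambda>xs. snd (prod_decode (xs ! 0 - 1)))"
  by (intro computes_prod_decode computes_pred computes_proj; simp)+

lemma computable_tl [computable_intros]: "computable f \<Longrightarrow> computable (\<lambda>x. tl (f x))"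
proof (rule computable_comp[where f = tl])
  show "computable (tl :: 'b list \<Rightarrow> 'b list)"
  proof (rule computableI[OF computes_hd_tl(2)])
    fix xs :: "'b list"
    have "snd (prod_decode 0) = 0" using prod_encode_inverse[of "(0, 0)"] by (simp add: prod_encode_def)
    then show "snd (prod_decode (enc xs - 1)) = enc (tl xs)" by (cases xs) auto
  qed
qed

text \<open>The default value covers the empty list, whose head is unspecified.\<close>

definition hd_or :: "'a \<Rightarrow> 'a list \<Rightarrow> 'a" where
  "hd_or d xs = (case xs of [] \<Rightarrow> d | x # _ \<Rightarrow> x)"

lemma computable_hd_or [computable_intros]: "computable f \<Longrightarrow> computable (\<lambda>x. hd_or d (f x))"
proof (rule computable_comp[where f = "hd_or d"])
  have c: "computes 2 (\<lambda>xs. rec_nat (enc d) (\<lambda>k r. fst (prod_decode (xs ! 1 - 1))) (xs ! 0))"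
    by (rule computes_rec[where g = "\<lambda>k r x. fst (prod_decode (x - 1))"])
       (intro computes_const computes_prod_decode computes_pred computes_proj; simp)+
  have "computes 1 (\<lambda>xs. rec_nat (enc d) (\<lambda>k r. fst (prod_decode (xs ! 0 - 1))) (xs ! 0))"
    by (rule computes_comp2[OF c]) (intro computes_proj; simp)+
  then show "computable (hd_or d)"
    by (rule computableI) (simp add: hd_or_def split: list.split)
qed

lemma length_le_enc: "length xs \<le> enc xs"
proof (induction xs)
  case (Cons x xs)
  then show ?case using le_prod_encode_2[of "enc xs" "enc x"] by simp
qed simp

text \<open>The state of the iteration consists of the accumulator and the remaining list. The code of a list is
  at least its length, so it can serve as the number of iterations; superfluous iterations
  leave the state unchanged.\<close>

lemma computable_foldl:
  fixes l :: "'a::encodable \<Rightarrow> 'c::encodable list" and i :: "'a \<Rightarrow> 'b::encodable"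
  assumes l: "computable l" and i: "computable i"
    and s: "computable (\<lambda>p. s (fst p) (fst (snd p)) (snd (snd p)))"
  shows "computable (\<lambda>x. foldl (\<lambda>r y. s r y x) (i x) (l x))"
proof -
  let ?step = "\<lambda>x q. (s (fst q) (hd_or undefined (snd q)) x, tl (snd q))"
  let ?it = "\<lambda>x q. if snd q = [] then q else ?step x q"
  have c: "computable (\<lambda>p. ?it (snd (snd p)) (fst (snd p)))"
    by (intro computable_if computable_eq computable_Pair computable_fst computable_snd computable_const
        computable_tl computable_hd_or computable_id
        computable_comp[OF s, where g = "\<lambda>p. (_ p, _ p, _ p)", simplified])
  have "computable (\<lambda>x. fst (rec_nat (i x, l x) (\<lambda>k q. ?it x q) (enc (l x))))"
    by (intro computable_fst computable_rec c computable_enc computable_Pair l i)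
  moreover have "fst (rec_nat (r, xs) (\<lambda>k q. ?it x q) n) = foldl (\<lambda>r y. s r y x) r xs" if "length xs \<le> n"
    for n r xs x
  proof -
    have shift: "rec_nat q (\<lambda>k. f) (Suc n) = rec_nat (f q) (\<lambda>k. f) n" for q n and f :: "'b \<times> 'c list \<Rightarrow> 'b \<times> 'c list"
      by (induction n) auto
    have nil: "rec_nat (r, []) (\<lambda>k q. ?it x q) n = (r, [])" for r n
      by (induction n) auto
    show ?thesis using that
    proof (induction xs arbitrary: n r)
      case Nil
      then show ?case by (simp add: nil)
    next
      case (Cons y xs)
      then obtain m where m: "n = Suc m" "length xs \<le> m" by (cases n) auto
      show ?case unfolding m(1) shift using Cons.IH[OF m(2)] by (simp add: hd_or_def)
    qed
  qed
  ultimately show ?thesis by (simp add: length_le_enc)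
qed

lemma computable_rev [computable_intros]: "computable f \<Longrightarrow> computable (\<lambda>x. rev (f x))"
proof -
  assume f: "computable f"
  have "computable (\<lambda>x. foldl (\<lambda>r y. y # r) [] (f x))"
    by (rule computable_foldl[OF f, where s = "\<lambda>r y x. y # r"]) (intro computable_intros)+
  moreover have "foldl (\<lambda>r y. y # r) r xs = rev xs @ r" for r and xs :: "'b list"
    by (induction xs arbitrary: r) auto
  ultimately show ?thesis by simp
qed

lemma computable_foldr:
  fixes l :: "'a::encodable \<Rightarrow> 'c::encodable list" and i :: "'a \<Rightarrow> 'b::encodable"
  assumes l: "computable l" and i: "computable i"
    and s: "computable (\<lambda>p. s (fst p) (fst (snd p)) (snd (snd p)))"
  shows "computable (\<lambda>x. foldr (\<lambda>y r. s y r x) (l x) (i x))"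
proof -
  have "computable (\<lambda>x. foldl (\<lambda>r y. s y r x) (i x) (rev (l x)))"
    by (rule computable_foldl[where s = "\<lambda>r y x. s y r x"]) (intro computable_rev l i
        computable_comp[OF s, where g = "\<lambda>p. (fst (snd p), fst p, snd (snd p))", simplified]
        computable_Pair computable_fst computable_snd computable_id)+
  then show ?thesis by (simp add: foldr_conv_foldl)
qed

lemma computable_append [computable_intros]: "computable f \<Longrightarrow> computable g \<Longrightarrow> computable (\<lambda>x. f x @ g x)"
proof -
  assume fg: "computable f" "computable g"
  have "computable (\<lambda>x. foldr (\<lambda>y r. y # r) (f x) (g x))"
    by (rule computable_foldr[OF fg, where s = "\<lambda>y r x. y # r"]) (intro computable_intros)+
  moreover have "foldr (\<lambda>y r. y # r) xs ys = xs @ ys" for xs ys :: "'b list" by (induction xs) auto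
  ultimately show ?thesis by simp
qed

lemma computable_bounded_ex:
  fixes b :: "'a::encodable \<Rightarrow> nat"
  assumes b: "computable b" and P: "computable (\<lambda>p. P (fst p) (snd p))"
  shows "computable (\<lambda>x. \<exists>k<b x. P k x)"
proof -
  have "computable (\<lambda>x. rec_nat False (\<lambda>k r. r \<or> P k x) (b x))"
    by (rule computable_rec[OF b, where s = "\<lambda>k r x. r \<or> P k x"])
      (intro computable_const computable_or computable_fst computable_snd computable_id
        computable_comp[OF P, where g = "\<lambda>p. (_ p, _ p)", simplified] computable_Pair)+
  moreover have "rec_nat False (\<lambda>k r. r \<or> P k x) m = (\<exists>k<m. P k x)" for m x
    by (induction m) (auto simp: less_Suc_eq)
  ultimately show ?thesis by simp
qed

lemma computable_list_all:
  assumes l: "computable l" and P: "computable (\<lambda>p. P (fst p) (snd p))"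
  shows "computable (\<lambda>x. \<forall>y\<in>set (l x). P y x)"
proof -
  have "computable (\<lambda>x. foldr (\<lambda>y r. P y x \<and> r) (l x) True)"
    by (rule computable_foldr[OF l, where s = "\<lambda>y r x. P y x \<and> r"])
      (intro computable_const computable_and computable_fst computable_snd computable_id
        computable_comp[OF P, where g = "\<lambda>p. (_ p, _ p)", simplified] computable_Pair)+
  moreover have "foldr (\<lambda>y r. P y x \<and> r) ys True = (\<forall>y\<in>set ys. P y x)" for ys x by (induction ys) auto
  ultimately show ?thesis by simp
qed

section \<open>The algorithm\<close>

lemma computable_times [computable_intros]:
  "computable f \<Longrightarrow> computable g \<Longrightarrow> computable (\<lambda>x. f x * g x :: nat)"
proof -
  assume fg: "computable f" "computable g"
  have "computable (\<lambda>x. rec_nat 0 (\<lambda>k r. r + g x) (f x))"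
    by (rule computable_rec[OF fg(1), where s = "\<lambda>k r x. r + g x"])
      (intro computable_intros computable_comp[OF fg(2)])+
  moreover have "rec_nat 0 (\<lambda>k r. r + m) n = n * m" for m n :: nat by (induction n) auto
  ultimately show ?thesis by simp
qed

lemma computable_replicate: "computable f \<Longrightarrow> computable (\<lambda>x. replicate (f x) c)"
proof -
  assume f: "computable f"
  have "computable (\<lambda>x. rec_nat [] (\<lambda>k r. c # r) (f x))"
    by (rule computable_rec[OF f, where s = "\<lambda>k r x. c # r"]) (intro computable_intros)+
  moreover have "rec_nat [] (\<lambda>k r. c # r) n = replicate n c" for n by (induction n) auto
  ultimately show ?thesis by simp
qed

lemma computable_map:
  assumes "computable f" "computable l"
  shows "computable (\<lambda>x. map f (l x))"
proof -
  have "computable (\<lambda>x. foldr (\<lambda>y r. f y # r) (l x) [])"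
    by (rule computable_foldr[OF assms(2), where s = "\<lambda>y r x. f y # r"])
      (intro computable_intros computable_comp[OF assms(1)])+
  moreover have "foldr (\<lambda>y r. f y # r) ys [] = map f ys" for ys by (induction ys) auto
  ultimately show ?thesis by simp
qed

lemma computable_list_decode: "computable f \<Longrightarrow> computable (\<lambda>x. list_decode (f x))"
  by (rule computable_from_enc) (simp add: enc_nat_def flip: list_encode_eq_enc)

text \<open>Bounds the codes of the finitely many lists that the search has to try.\<close>

lemma enc_mono:
  assumes "length xs = n" "\<forall>x\<in>set xs. x \<le> (c :: nat)"
  shows "enc xs \<le> enc (replicate n c)"
  using assms
proof (induction xs arbitrary: n)
  case (Cons x xs)
  then obtain m where m: "n = Suc m" "enc xs \<le> enc (replicate m c)" by auto
  have "triangle (x + enc xs) \<le> triangle (c + enc (replicate m c))"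
    using Cons.prems m(2) by (intro triangle_mono add_mono) auto
  then show ?case
    using Cons.prems by (simp add: m(1) prod_encode_def enc_nat_def)
qed simp

lemma enc_member_le: "x \<in> set xs \<Longrightarrow> enc x \<le> enc xs"
proof (induction xs)
  case (Cons y xs)
  have "enc y \<le> enc (y # xs)" "enc xs \<le> enc (y # xs)"
    using le_prod_encode_1[of "enc y" "enc xs"] le_prod_encode_2[of "enc xs" "enc y"] by simp_all
  with Cons show ?case by (auto intro: order_trans)
qed simp

lemma computable_reduce: "computable (reduce :: basis word \<Rightarrow> basis word)"
proof -
  have eq: "cancel_cons x w = (if w \<noteq> [] \<and> hd_or (A, True) w = inv_letter x then tl w else x # w)"
    for x :: "basis letter" and w
    by (cases w) (auto simp: hd_or_def)
  have "computable (\<lambda>w :: basis word. foldr (\<lambda>x r. cancel_cons x r) w [])"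
    unfolding eq
    by (rule computable_foldr[where s = "\<lambda>x w _. if w \<noteq> [] \<and> hd_or (A, True) w = inv_letter x then tl w else x # w"])
      (intro computable_intros computable_comp[OF computable_finite[of inv_letter]])+
  then show ?thesis by (simp add: reduce_def[abs_def])
qed

lemma computable_subst:
  assumes "computable m" "computable w"
  shows "computable (\<lambda>x. subst (m x) (w x))"
proof -
  have eq: "subst_letter m x = (if m = 0 then subst_letter 0 x else if m = 1 then subst_letter 1 x
      else if m = 2 then subst_letter 2 x else if m = 3 then subst_letter 3 x else subst_letter 4 x)" for m x
    by (auto simp: subst_letter_def move_img_def)
  have letter: "computable (\<lambda>p. subst_letter (fst p) (snd p))"
    unfolding eq[of "fst _"]
    by (intro computable_intros computable_comp[OF computable_finite[of "subst_letter _"]])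
  have "computable (\<lambda>p. foldr (\<lambda>y r. subst_letter (fst p) y @ r) (snd p) [])"
    by (rule computable_foldr[where s = "\<lambda>y r p. subst_letter (fst p) y @ r"])
      (intro computable_intros computable_comp[OF letter, where g = "\<lambda>p. (_ p, _ p)", simplified])+
  moreover have "foldr (\<lambda>y r. subst_letter m y @ r) w [] = subst m w" for m w
    by (induction w) (simp_all add: subst_def)
  ultimately have "computable (\<lambda>p. subst (fst p) (snd p))" by simp
  from computable_comp[OF this computable_Pair[OF assms]] show ?thesis by simp
qed

text \<open>The theta graph with empty stem as a deterministic automaton with the dead state \<open>3\<close>.\<close>

definition run :: "nat \<Rightarrow> basis letter \<Rightarrow> nat" where
  "run u x = (if \<exists>v. step (theta []) u x v then THE v. step (theta []) u x v else 3)"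

lemma run_eq:
  assumes "step (theta []) u x v"
  shows "run u x = v"
proof -
  have "(THE v. step (theta []) u x v) = v"
    using assms by (rule the_equality) (rule folded_step[OF folded_theta _ assms])
  moreover have "\<exists>v. step (theta []) u x v" using assms by blast
  ultimately show ?thesis unfolding run_def by (simp only: if_True)
qed

lemma run_dead:
  assumes "2 < u"
  shows "run u x = 3"
proof -
  have "\<not> step (theta []) u x v" for v
    using assms by (simp add: step_def theta_def)
  then show ?thesis by (simp add: run_def)
qed

lemma path_iff_run: "v \<noteq> 3 \<Longrightarrow> path (theta []) u w v \<longleftrightarrow> foldl run u w = v"
proof (induction w arbitrary: u)
  case (Cons x w)
  have dead: "foldl run 3 w = 3" for w
  proof (induction w)
    case (Cons x w)
    then show ?case by (simp add: run_dead)
  qed simp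
  show ?case
  proof (cases "\<exists>m. step (theta []) u x m")
    case True
    then obtain m where m: "step (theta []) u x m" by blast
    have "m' = m" if "step (theta []) u x m'" for m'
      using folded_step[OF folded_theta that m] .
    with m have "path (theta []) u (x # w) v \<longleftrightarrow> path (theta []) m w v"
      unfolding path.simps by blast
    with Cons.IH[OF Cons.prems, of m] run_eq[OF m] show ?thesis by (simp only: foldl_Cons)
  next
    case False
    then have "run u x = 3" by (simp add: run_def)
    with dead Cons.prems have "foldl run u (x # w) \<noteq> v" by simp
    with False show ?thesis by simp
  qed
qed simp

lemma computable_accepts: "computable (\<lambda>w. path (theta []) 0 w 0)"
proof -
  have eq: "run u x = (if u = 0 then run 0 x else if u = 1 then run 1 x else if u = 2 then run 2 x else 3)" for u x
  proof -
    consider "u = 0" | "u = 1" | "u = 2" | "2 < u" by linarith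
    then show ?thesis by cases (simp_all add: run_dead)
  qed
  have run: "computable (\<lambda>p. run (fst p) (snd p))"
    unfolding eq[of "fst _"]
    by (intro computable_intros computable_comp[OF computable_finite[of "run _"]])
  have "computable (\<lambda>w. foldl (\<lambda>r x. run r x) 0 w)"
    by (rule computable_foldl[where s = "\<lambda>r x w. run r x"])
      (intro computable_intros computable_comp[OF run, where g = "\<lambda>p. (_ p, _ p)", simplified])+
  then have "computable (\<lambda>w. foldl run 0 w = 0)" by (intro computable_intros)
  then show ?thesis by (simp add: path_iff_run)
qed

definition letter_of :: "nat \<Rightarrow> basis letter" where
  "letter_of n = (if n = 0 then (A, True) else if n = 1 then (A, False)
    else if n = 2 then (B, True) else (B, False))"

lemma letter_of_code: "letter_of (letter_code x) = x"
  by (cases x rule: letter_code.cases) (auto simp: letter_of_def)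

lemma computable_letter_of: "computable letter_of"
  unfolding letter_of_def[abs_def] by (intro computable_intros)

definition embeds_by :: "nat list \<Rightarrow> basis word \<Rightarrow> bool" where
  "embeds_by ms w \<longleftrightarrow> path (theta []) 0 (reduce (foldl (\<lambda>w m. subst m w) w ms)) 0"

lemma embeds_by_iff: "embeds_by ms w \<longleftrightarrow> moves ms (of_word w) \<in> sg (Zgen [])"
  unfolding embeds_by_def word_of_of_word[symmetric] of_word_foldl_subst
  by (simp add: Zgen_eq_stem_gens sg_stem_gens_iff)

lemma computable_embeds_by:
  assumes "computable ms" "computable w"
  shows "computable (\<lambda>x. embeds_by (ms x) (w x))"
proof -
  have "computable (\<lambda>x. foldl (\<lambda>w m. subst m w) (w x) (ms x))"
    by (rule computable_foldl[OF assms, where s = "\<lambda>w m x. subst m w"])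
      (intro computable_subst computable_intros)
  from computable_comp[OF computable_accepts computable_comp[OF computable_reduce this]]
  show ?thesis by (simp add: embeds_by_def)
qed

text \<open>The code of the input bounds the length of each of the given words, and therefore replaces \<open>L\<close> in
  the bound for the number of moves.\<close>

theorem theorem3p14:
  shows "decidable {ws. \<exists>\<phi> \<in> auto F2.
           \<phi> ` subgroup_of_words ws \<subseteq> generate F2 {gen A, conjugate F2 (gen A) (gen B)}}"
    (is "decidable ?P")
proof -
  define N where "N xss = 150 * enc xss + 82" for xss :: "nat list list"
  define D where "D xss \<longleftrightarrow> (\<exists>c<Suc (enc (replicate (N xss) (4::nat))).
    \<forall>xs\<in>set xss. embeds_by (list_decode c) (map letter_of xs))" for xss
  have "computable D"
    unfolding D_def[abs_def] N_def
    by (intro computable_bounded_ex computable_list_all computable_embeds_by computable_map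
        computable_replicate computable_list_decode computable_letter_of computable_intros)
  then obtain h where h: "computes 1 (\<lambda>xs. h (xs ! 0))" "\<And>xss. h (enc xss) = enc (D xss)"
    unfolding computable_def by blast
  from h(1) obtain f where rec: "recursive 1 f" and "\<forall>xs. length xs = 1 \<longrightarrow> f xs = h (xs ! 0)"
    unfolding computes_def by blast
  then have f: "f [n] = h n" for n by simp
  have "D (map (map letter_code) ws) \<longleftrightarrow> ws \<in> ?P" for ws
  proof -
    let ?xss = "map (map letter_code) ws"
    have len: "length w \<le> enc ?xss" if "w \<in> set ws" for w
    proof -
      have "length w \<le> enc (map letter_code w)" using length_le_enc[of "map letter_code w"] by simp
      also have "\<dots> \<le> enc ?xss" using that by (intro enc_member_le) simp
      finally show ?thesis .
    qed
    have test: "(\<forall>xs\<in>set ?xss. embeds_by ms (map letter_of xs)) \<longleftrightarrow>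
        (\<forall>w\<in>set ws. moves ms (of_word w) \<in> sg (Zgen []))" for ms
      by (simp add: embeds_by_iff comp_def letter_of_code)
    show ?thesis
    proof
      assume "D ?xss"
      then obtain ms where "\<forall>w\<in>set ws. moves ms (of_word w) \<in> sg (Zgen [])"
        unfolding D_def test by blast
      then show "ws \<in> ?P" by (simp add: embeddable_if_moves)
    next
      assume "ws \<in> ?P"
      then have "embeddable ws" by simp
      from this len obtain ms where ms: "length ms = 150 * enc ?xss + 82" "set ms \<subseteq> {..4}"
        "\<forall>w\<in>set ws. moves ms (of_word w) \<in> sg (Zgen [])"
        by (rule moves_if_embeddable)
      have "enc ms \<le> enc (replicate (N ?xss) (4::nat))"
        using ms by (intro enc_mono) (auto simp: N_def)
      moreover have "list_decode (enc ms) = ms"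
        using list_encode_inverse[of ms] by (simp only: list_encode_eq_enc)
      ultimately show "D ?xss" unfolding D_def test using ms(3) by (intro exI[of _ "enc ms"]) simp
    qed
  qed
  moreover have "words_code ws = enc (map (map letter_code) ws)" for ws
  proof -
    have "map word_code ws = map enc (map (map letter_code) ws)"
      by (simp add: word_code_def list_encode_eq_enc)
    then show ?thesis by (simp only: words_code_def enc_list_def)
  qed
  ultimately have "f [words_code ws] = (if ws \<in> ?P then 1 else 0)" for ws
    by (simp add: f h(2) enc_bool_def)
  with rec show ?thesis unfolding decidable_def by blast
qed

end
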